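(* Let $\Bbbk\in\{\mathbb{R},\mathbb{C}\}$, let $\mathcal{X}\subseteq\Bbbk^n$ be a model, let $\mu=(\mu_1,\dots,\mu_s):\mathcal{X}\to\Bbbk^s$ be the restriction to $\mathcal X$ of a polynomial map $\Bbbk^n\to\Bbbk^s$, and let $y=(y_1,\dots,y_s)\in\Bbbk^s$. (1) If $\mathcal{X}=\{x\in\Bbbk^n: f_1(x)=\dots=f_k(x)=0\}$ with $f_i\in\Bbbk[x_1,\dots,x_n]$, then there is $x\in\mathcal{X}$ with $y=\mu(x)$ if and only if the system of $k+s$ polynomial equations $f_1(x)=\cdots=f_k(x)=y_1-\mu_1(x)=\cdots=y_s-\mu_s(x)=0$ in the variables $x_1,\dots,x_n$ has a solution in $\Bbbk^n$. (2) If $\mathcal{X}=\phi(\Bbbk^\ell)$ for a polynomial map $\phi=(\phi_1,\dots,\phi_n):\Bbbk^\ell\to\Bbbk^n$, then there is $x\in\mathcal{X}$ with $y=\mu(x)$ if and only if the system of $s$ polynomial equations $y_1-\mu_1(\phi_1(t),\dots,\phi_n(t))=\cdots=y_s-\mu_s(\phi_1(t),\dots,\phi_n(t))=0$ in the variables $t_1,\dots,t_\ell$ has a solution in $\Bbbk^\ell$. (3) Write either of these systems as $g_1=\cdots=g_N=0$, and let $I=\langle g_1,\dots,g_N\rangle$ be the ideal generated by the $g_i$ in the corresponding polynomial ring over $\Bbbk$. If $\Bbbk=\mathbb{C}$, the system has a solution if and only if $1\notin I$. If $\Bbbk=\mathbb{R}$, the system has a solution if and only if $1$ is not contained in the real radical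 of $I$.
   Context: The real radical of an ideal $I\subseteq\mathbb{R}[z_1,\dots,z_m]$ is the set of polynomials $f$ such that $f^{2a}+h_1^2+\cdots+h_b^2\in I$ for some integers $a\ge1$, $b\ge 0$ and polynomials $h_1,\dots,h_b\in\mathbb{R}[z_1,\dots,z_m]$. $s\ge 1$ is an integer. *)

theory Defs
  imports "HOL-Analysis.Analysis" "HOL-Library.Poly_Mapping"
begin

text \<open>
  Polynomials over \<open>'a\<close> in the variables \<open>x\<^sub>i\<close>, \<open>i :: 'n\<close>: finitely supported maps from exponent
  vectors to coefficients, with the ring structure (convolution product) of
  \<^theory>\<open>HOL-Library.Poly_Mapping\<close>.
\<close>

type_synonym ('n, 'a) mpoly = "('n \<Rightarrow>\<^sub>0 nat) \<Rightarrow>\<^sub>0 'a"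

definition mp_const :: "'a \<Rightarrow> ('n, 'a::zero) mpoly" where
  "mp_const c = Poly_Mapping.single 0 c"

definition mp_eval :: "'a ^ 'n \<Rightarrow> ('n::finite, 'a::comm_ring_1) mpoly \<Rightarrow> 'a" where
  "mp_eval x p =
     (\<Sum>a\<in>Poly_Mapping.keys p. Poly_Mapping.lookup p a * (\<Prod>i\<in>UNIV. (x $ i) ^ Poly_Mapping.lookup a i))"

definition mp_subst ::
    "('n \<Rightarrow> ('l, 'a) mpoly) \<Rightarrow> ('n::finite, 'a::comm_ring_1) mpoly \<Rightarrow> ('l, 'a) mpoly" where
  "mp_subst q p =
     (\<Sum>a\<in>Poly_Mapping.keys p.
        mp_const (Poly_Mapping.lookup p a) * (\<Prod>i\<in>UNIV. q i ^ Poly_Mapping.lookup a i))"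

definition poly_map ::
    "('m \<Rightarrow> ('n, 'a) mpoly) \<Rightarrow> 'a::comm_ring_1 ^ 'n::finite \<Rightarrow> 'a ^ 'm::finite" where
  "poly_map p x = (\<chi> j. mp_eval x (p j))"

definition solvable :: "('n::finite, 'a::comm_ring_1) mpoly set \<Rightarrow> bool" where
  "solvable G \<longleftrightarrow> (\<exists>x. \<forall>g\<in>G. mp_eval x g = 0)"

definition implicit_system ::
    "nat \<Rightarrow> (nat \<Rightarrow> ('n, 'a) mpoly) \<Rightarrow> ('s \<Rightarrow> ('n, 'a) mpoly) \<Rightarrow> 'a ^ 's
      \<Rightarrow> ('n::finite, 'a::comm_ring_1) mpoly set" where
  "implicit_system k f m y = f ` {1..k} \<union> range (\<lambda>j. mp_const (y $ j) - m j)"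

definition parametric_system ::
    "('n \<Rightarrow> ('l, 'a) mpoly) \<Rightarrow> ('s \<Rightarrow> ('n::finite, 'a) mpoly) \<Rightarrow> 'a ^ 's
      \<Rightarrow> ('l::finite, 'a::comm_ring_1) mpoly set" where
  "parametric_system q m y = range (\<lambda>j. mp_const (y $ j) - mp_subst q (m j))"

text \<open>
  A commutative ring is a module over itself; \<open>ideal.span G\<close> is the ideal generated by \<open>G\<close>.
\<close>

global_interpretation ideal: module "(*) :: 'a::comm_ring_1 \<Rightarrow> 'a \<Rightarrow> 'a"
  by standard (simp_all add: algebra_simps)

definition real_radical :: "('n, real) mpoly set \<Rightarrow> ('n, real) mpoly set" where
  "real_radical I =
     {f. \<exists>a\<ge>1. \<exists>b. \<exists>h :: nat \<Rightarrow> ('n, real) mpoly. f ^ (2 * a) + (\<Sum>i\<in>{1..b}. (h i)\<^sup>2) \<in> I}"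

end

theory Submission
  imports "HOL-Algebra.Algebraic_Closure_Type" Defs
begin

text \<open>
  Whether \<open>y\<close> lies in the image of the model is by construction the solvability of the system, so
  parts (1) and (2) only need that evaluation is a ring homomorphism compatible with substitution.
  Part (3) is the weak Nullstellensatz over \<open>\<complex>\<close> and over \<open>\<real>\<close>; in both cases a common zero is an
  obstruction, by evaluating a certificate at it, and the work lies in the converse.

  Over \<open>\<complex>\<close>, let \<open>M\<close> be a maximal ideal above the given one. If no \<open>x\<^sub>i - \<lambda>\<close> were in \<open>M\<close>, then all
  \<open>1 / (x\<^sub>i - \<lambda>)\<close> would exist modulo \<open>M\<close>; these are uncountably many elements of a space of countable
  dimension, hence linearly dependent, and clearing denominators in a dependency puts a nonzero
  polynomial in \<open>x\<^sub>i\<close>, hence one of its linear factors, into \<open>M\<close>. So \<open>M\<close> is the ideal of a point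
  (\<open>maximal_contains_linear\<close>).

  Over \<open>\<real>\<close>, suppose that no \<open>1 + \<Sum>h\<^sub>i\<^sup>2\<close> lies in the ideal. A maximal ideal \<open>J\<close> with this property is
  prime, and its residue ring is a domain in which a sum of squares vanishes only trivially
  (\<open>real_prime_exists\<close>). The fraction field is therefore formally real and has a real closed
  extension \<open>L\<close>, obtained as a maximal ordered subfield of the algebraic closure
  (\<open>real_closure_IVT\<close>). The classes of the variables form a common zero of the system in \<open>L\<close>, and
  what remains is Tarski's transfer principle: a finite system over \<open>\<real>\<close> with a zero in a real closed
  extension has a zero in \<open>\<real>\<close> (\<open>solvable_transfer\<close>).

  Transfer is proved by eliminating one variable at a time (\<open>eliminate_variable\<close>). A finite set of
  univariate polynomials is closed up under derivatives, pseudo-remainders and removal of the leading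
  term. If the constants of the closed set have the same signs for two specialisations of the
  coefficients, then the real roots on the two sides correspond to each other in the same order and
  all polynomials of the set have the same signs at corresponding points. This is shown by adding the
  polynomials in order of their degrees: at an old root the sign of a new polynomial is that of a
  remainder, and on an interval between old roots it is monotone, so the signs at the ends decide
  whether it has a root inside.
\<close>

no_notation Polynomials.var (\<open>X\<index>\<close>)
hide_const (open) Polynomials.lead_coeff Polynomials.degree Module.smult UnivPoly.monom UnivPoly.coeff UnivPoly.deg

text \<open>
  Seen as a law of scalar multiplication, associativity has become a rewrite rule towards the left,
  which does not terminate together with \<open>mult.assoc\<close>.
\<close>

declare ideal.scale_scale [simp del]

section \<open>Polynomials over real closed fields\<close>

text \<open>
  The intermediate value property of polynomials characterises real closed fields among the ordered
  fields. A class axiom cannot mention polynomials over the type that is being classified, hence the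
  sum of powers.
\<close>

class real_closed_field = linordered_field +
  assumes sum_powers_IVT:
    "a < b \<Longrightarrow> (\<Sum>k\<le>n. f k * a ^ k) < 0 \<Longrightarrow> 0 < (\<Sum>k\<le>n. f k * b ^ k) \<Longrightarrow>
      \<exists>c>a. c < b \<and> (\<Sum>k\<le>n. f k * c ^ k) = 0"

lemma rcf_IVT:
  fixes p :: "'a :: real_closed_field poly"
  assumes "a < b" "poly p a * poly p b < 0"
  obtains c where "a < c" "c < b" "poly p c = 0"
proof -
  have *: "\<exists>c>a. c < b \<and> poly q c = 0" if "poly q a < 0" "poly q b > 0" for q :: "'a poly"
    using sum_powers_IVT[OF assms(1), where n = "degree q" and f = "coeff q"] that by (simp add: poly_altdef)
  from assms(2) consider "poly p a < 0" "poly p b > 0" | "poly p a > 0" "poly p b < 0"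
    by (auto simp: mult_less_0_iff)
  then show ?thesis
    using *[of p] *[of "- p"] that by cases auto
qed

instance real :: real_closed_field
proof
  fix a b :: real and f :: "nat \<Rightarrow> real" and n :: nat
  assume *: "a < b" "(\<Sum>k\<le>n. f k * a ^ k) < 0" "0 < (\<Sum>k\<le>n. f k * b ^ k)"
  show "\<exists>c>a. c < b \<and> (\<Sum>k\<le>n. f k * c ^ k) = 0"
    using poly_IVT_pos[of a b "\<Sum>k\<le>n. monom (f k) k"] * by (simp add: poly_sum poly_monom)
qed

text \<open>
  Completeness is not available, so the classical proof by an interior maximum does not apply. Between
  two consecutive roots \<open>a\<close> and \<open>d\<close> one writes \<open>p = (X - a)\<^sup>m (X - d)\<^sup>n g\<close>, where \<open>g\<close> has constant sign on
  \<open>[a, d]\<close>. The derivative is \<open>(X - a)\<^sup>m\<^sup>-\<^sup>1 (X - d)\<^sup>n\<^sup>-\<^sup>1 h\<close>, and \<open>h\<close> has opposite signs at \<open>a\<close> and \<open>d\<close>.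
\<close>

lemma rcf_rolle:
  fixes p :: "'a :: real_closed_field poly"
  assumes "a < b" "poly p a = 0" "poly p b = 0"
  obtains c where "a < c" "c < b" "poly (pderiv p) c = 0"
proof (cases "p = 0")
  case True
  show ?thesis using that[of "(a + b) / 2"] True assms(1) by auto
next
  case False
  \<comment> \<open>Only consecutive roots bound an interval on which \<open>g\<close> below cannot change sign.\<close>
  define R where "R = {x. a < x \<and> x \<le> b \<and> poly p x = 0}"
  have "finite R" "b \<in> R"
    using poly_roots_finite[OF False] assms unfolding R_def
    by (auto intro: finite_subset[of _ "{x. poly p x = 0}"])
  define d where "d = Min R"
  have "d \<in> R" using \<open>finite R\<close> \<open>b \<in> R\<close> unfolding d_def by (metis Min_in empty_iff)
  then have d: "a < d" "d \<le> b" "poly p d = 0" by (auto simp: R_def)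
  have no_root: "poly p x \<noteq> 0" if "a < x" "x < d" for x
  proof
    assume "poly p x = 0"
    then have "x \<in> R" using that d by (auto simp: R_def)
    then show False using \<open>finite R\<close> that unfolding d_def by (meson Min_le not_le)
  qed
  define A B where "A = [:- a, 1:]" and "B = [:- d, 1:]"
  obtain q where q: "p = A ^ order a p * q" "\<not> A dvd q"
    using order_decomp[OF False] unfolding A_def by metis
  have "q \<noteq> 0" using q(2) by auto
  have qa: "poly q a \<noteq> 0" using q(2) unfolding A_def by (simp add: poly_eq_0_iff_dvd)
  obtain g where g: "q = B ^ order d q * g" "\<not> B dvd g"
    using order_decomp[OF \<open>q \<noteq> 0\<close>] unfolding B_def by metis
  have gd: "poly g d \<noteq> 0" using g(2) unfolding B_def by (simp add: poly_eq_0_iff_dvd)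
  have ga: "poly g a \<noteq> 0" using qa g(1) by (metis mult_zero_right poly_mult)
  have "order a p \<noteq> 0" using assms(2) False by (simp add: order_root)
  then obtain m where m: "order a p = Suc m" by (meson not0_implies_Suc)
  have "poly (A ^ order a p * q) d = 0" using d(3) q(1) by metis
  then have "poly q d = 0" using d(1) unfolding A_def by (simp add: poly_power)
  then have "order d q \<noteq> 0" using \<open>q \<noteq> 0\<close> by (simp add: order_root)
  then obtain n where n: "order d q = Suc n" by (meson not0_implies_Suc)
  have p: "p = A ^ Suc m * B ^ Suc n * g" 
    using q(1)[unfolded m] g(1)[unfolded n] by (metis mult.assoc)
  define h where "h = of_nat (Suc m) * B * g + of_nat (Suc n) * A * g + A * B * pderiv g"
  have AB: "pderiv A = 1" "pderiv B = 1" by (simp_all add: A_def B_def pderiv_pCons)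
  have sm: "smult (of_nat k) u = of_nat k * u" for k and u :: "'a poly"
    by (simp add: of_nat_poly)
  have pd: "pderiv p = A ^ m * B ^ n * h"
    unfolding p pderiv_mult pderiv_power_Suc AB sm mult_1_right
    unfolding h_def power_Suc by (simp only: ring_distribs mult_ac add_ac)
  have AB_at: "poly A a = 0" "poly A d = d - a" "poly B a = a - d" "poly B d = 0"
    by (simp_all add: A_def B_def)
  have ha: "poly h a = of_nat (Suc m) * (a - d) * poly g a"
    by (simp add: h_def AB_at of_nat_poly del: of_nat_Suc)
  have hd: "poly h d = of_nat (Suc n) * (d - a) * poly g d"
    by (simp add: h_def AB_at of_nat_poly del: of_nat_Suc)
  have same: "poly g a * poly g d > 0"
  proof (rule ccontr)
    assume "\<not> ?thesis"
    then have "poly g a * poly g d < 0" using ga gd by (simp add: not_less order_le_less)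
    then obtain c where "a < c" "c < d" "poly g c = 0" using rcf_IVT d(1) by blast
    then show False using no_root[of c] p by simp
  qed
  have "poly h a * poly h d = - ((of_nat (Suc m) * of_nat (Suc n)) * (d - a)\<^sup>2) * (poly g a * poly g d)"
    unfolding ha hd power2_eq_square minus_diff_eq[symmetric, of d a]
    by (simp only: mult_minus_left mult_minus_right minus_minus mult_ac)
  moreover have "of_nat (Suc m) * of_nat (Suc n) * (d - a)\<^sup>2 > 0"
    using d(1) by (simp del: of_nat_Suc)
  then have "of_nat (Suc m) * of_nat (Suc n) * (d - a)\<^sup>2 * (poly g a * poly g d) > 0"
    using same by (rule mult_pos_pos)
  ultimately have "poly h a * poly h d < 0"
    by (simp only: mult_minus_left neg_less_0_iff_less)
  then obtain c where "a < c" "c < d" "poly h c = 0" using rcf_IVT d(1) by blast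
  then show ?thesis using that[of c] d pd by auto
qed

lemma rcf_MVT:
  fixes p :: "'a :: real_closed_field poly"
  assumes "a < b"
  obtains c where "a < c" "c < b" "poly p b - poly p a = (b - a) * poly (pderiv p) c"
proof -
  define q where
    "q = smult (b - a) p - [:(b - a) * poly p a - (poly p b - poly p a) * a, poly p b - poly p a:]"
  have "poly q a = 0" "poly q b = 0" unfolding q_def by (simp_all add: algebra_simps)
  then obtain c where c: "a < c" "c < b" "poly (pderiv q) c = 0"
    using rcf_rolle[OF assms] by metis
  have "poly (pderiv q) c = (b - a) * poly (pderiv p) c - (poly p b - poly p a)"
    unfolding q_def by (simp add: pderiv_diff pderiv_smult pderiv_pCons)
  then show ?thesis using c that[of c] by simp
qed

lemma rcf_strict_increasing:
  fixes p :: "'a :: real_closed_field poly"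
  assumes "a < b" "\<And>t. a < t \<Longrightarrow> t < b \<Longrightarrow> poly (pderiv p) t > 0"
  shows "poly p a < poly p b"
proof -
  obtain c where c: "a < c" "c < b" "poly p b - poly p a = (b - a) * poly (pderiv p) c"
    using rcf_MVT[OF assms(1)] by blast
  have "(b - a) * poly (pderiv p) c > 0" using assms c by simp
  then show ?thesis using c(3) by simp
qed

lemma lead_coeff_pos_imp_eventually_pos:
  fixes p :: "'a :: linordered_field poly"
  assumes "lead_coeff p > 0"
  obtains B where "\<And>x. x \<ge> B \<Longrightarrow> poly p x > 0"
proof -
  have "\<exists>B. \<forall>x\<ge>B. poly p x \<ge> lead_coeff p" using assms
  proof (induction p)
    case (pCons a p)
    show ?case
    proof (cases "p = 0")
      case False
      then have lc: "lead_coeff p > 0" using pCons by simp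
      then obtain B where B: "\<forall>x\<ge>B. poly p x \<ge> lead_coeff p" using pCons by blast
      have "poly (pCons a p) x \<ge> lead_coeff (pCons a p)"
        if x: "x \<ge> max B (1 + \<bar>a\<bar> / lead_coeff p)" for x
      proof -
        have "x \<ge> 0" using x lc by (smt (verit) abs_ge_zero divide_nonneg_pos le_add_same_cancel1 max.bounded_iff order_trans zero_le_one)
        have "lead_coeff p + \<bar>a\<bar> = (1 + \<bar>a\<bar> / lead_coeff p) * lead_coeff p"
          using False by (simp add: distrib_right)
        also have "\<dots> \<le> x * lead_coeff p" using x lc by (intro mult_right_mono) auto
        also have "\<dots> \<le> x * poly p x" using B x \<open>x \<ge> 0\<close> by (intro mult_left_mono) auto
        finally have "lead_coeff p \<le> a + x * poly p x" using abs_ge_minus_self[of a] by linarith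
        then show ?thesis using False by simp
      qed
      then show ?thesis by blast
    qed auto
  qed auto
  then show ?thesis using that assms by (meson less_le_trans)
qed

section \<open>Signs on corresponding intervals\<close>

definition same_sign :: "'a :: linordered_idom \<Rightarrow> 'b :: linordered_idom \<Rightarrow> bool" where
  "same_sign x y \<longleftrightarrow> (x < 0 \<longleftrightarrow> y < 0) \<and> (0 < x \<longleftrightarrow> 0 < y)"

lemma same_sign_sym: "same_sign x y \<Longrightarrow> same_sign y x"
  by (auto simp: same_sign_def)

lemma same_sign_eq_0: "same_sign x y \<Longrightarrow> x = 0 \<longleftrightarrow> y = 0"
  unfolding same_sign_def by (metis linorder_neqE order.irrefl)

lemma same_sign_minus [simp]: "same_sign (- x) (- y) \<longleftrightarrow> same_sign x y"
  by (auto simp: same_sign_def)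

lemma same_sign_mult: "same_sign x y \<Longrightarrow> same_sign x' y' \<Longrightarrow> same_sign (x * x') (y * y')"
  using same_sign_eq_0[of x y] same_sign_eq_0[of x' y']
  by (auto simp: same_sign_def mult_less_0_iff zero_less_mult_iff)

lemma same_sign_power: "same_sign x y \<Longrightarrow> same_sign (x ^ n) (y ^ n)"
  by (induction n) (auto intro: same_sign_mult simp: same_sign_def[of 1])

lemma same_sign_mult_cancel:
  assumes "same_sign c d" "c \<noteq> 0" "same_sign (c * x) (d * y)"
  shows "same_sign x y"
proof -
  consider "c > 0" "d > 0" | "c < 0" "d < 0"
    using assms(1,2) unfolding same_sign_def by (metis neq_iff)
  then show ?thesis using assms(3)
    by cases (auto simp: same_sign_def mult_less_0_iff zero_less_mult_iff)
qed

text \<open>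
  A set \<open>Z\<close> of pairs of points, one in each of two ordered fields, subdivides both lines; matched
  points have the same position with respect to the two subdivisions.
\<close>

definition matched :: "('a \<times> 'b) set \<Rightarrow> 'a :: linorder \<Rightarrow> 'b :: linorder \<Rightarrow> bool" where
  "matched Z x y \<longleftrightarrow> (\<forall>(a, b)\<in>Z. (x < a \<longleftrightarrow> y < b) \<and> (a < x \<longleftrightarrow> b < y))"

lemma matchedD:
  assumes "matched Z x y" "(a, b) \<in> Z"
  shows "x < a \<longleftrightarrow> y < b" "a < x \<longleftrightarrow> b < y" "x = a \<longleftrightarrow> y = b" "x \<le> a \<longleftrightarrow> y \<le> b" "a \<le> x \<longleftrightarrow> b \<le> y"
  using assms unfolding matched_def by (auto simp: not_less[symmetric])

lemma matched_converse: "matched (Z\<inverse>) y x \<longleftrightarrow> matched Z x y"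
  by (auto simp: matched_def)

lemma between_finite_sets:
  fixes S U :: "'a :: linordered_field set"
  assumes "finite S" "finite U" "\<And>s u. s \<in> S \<Longrightarrow> u \<in> U \<Longrightarrow> s < u"
  obtains y where "\<And>s. s \<in> S \<Longrightarrow> s < y" "\<And>u. u \<in> U \<Longrightarrow> y < u"
proof (cases "S = {}")
  case True
  show ?thesis
  proof (cases "U = {}")
    case False
    show ?thesis
    proof (rule that[of "Min U - 1"])
      fix u assume "u \<in> U"
      then have "Min U \<le> u" using assms(2) by simp
      then show "Min U - 1 < u" by (meson diff_less zero_less_one diff_less_eq less_add_one less_le_trans)
    qed (use True in auto)
  qed (use True that in auto)
next
  case S: False
  show ?thesis
  proof (cases "U = {}")
    case True
    show ?thesis
    proof (rule that[of "Max S + 1"])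
      fix s assume "s \<in> S"
      then have "s \<le> Max S" using assms(1) by simp
      then show "s < Max S + 1" by (meson less_add_one le_less_trans)
    qed (use True in auto)
  next
    case False
    have "Max S < Min U" using S False assms by simp
    then obtain y where y: "Max S < y" "y < Min U" using dense by blast
    show ?thesis
      by (rule that[of y])
        (use y assms(1,2) in \<open>meson le_less_trans Max_ge less_le_trans Min_le\<close>)+
  qed
qed

lemma matched_partner:
  fixes Z :: "('a :: linordered_field \<times> 'b :: linordered_field) set"
  assumes "finite Z" "\<And>a b. (a, b) \<in> Z \<Longrightarrow> matched Z a b"
  obtains y where "matched Z x y"
proof (cases "\<exists>b. (x, b) \<in> Z")
  case True
  then show ?thesis using assms that by blast
next
  case False
  define S U where "S = snd ` {z \<in> Z. fst z < x}" and "U = snd ` {z \<in> Z. x < fst z}"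
  have "finite S" "finite U" using assms(1) by (auto simp: S_def U_def)
  moreover have "s < u" if "s \<in> S" "u \<in> U" for s u
    using that assms(2) unfolding S_def U_def by (force dest: matchedD)
  ultimately obtain y where y: "\<And>s. s \<in> S \<Longrightarrow> s < y" "\<And>u. u \<in> U \<Longrightarrow> y < u"
    using between_finite_sets by metis
  have "matched Z x y" unfolding matched_def
  proof safe
    fix a b assume ab: "(a, b) \<in> Z"
    then have "a \<noteq> x" using False by auto
    have 1: "b < y" if "a < x" using y(1)[of b] that ab unfolding S_def by force
    have 2: "y < b" if "x < a" using y(2)[of b] that ab unfolding U_def by force
    show "x < a \<Longrightarrow> y < b" "a < x \<Longrightarrow> b < y" using 1 2 by auto
    show "y < b \<Longrightarrow> x < a" "b < y \<Longrightarrow> a < x" using 1 2 \<open>a \<noteq> x\<close> by (metis neq_iff order.asym)+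
  qed
  then show ?thesis using that by blast
qed

text \<open>
  The situation in which a polynomial is added to a table: \<open>x\<close> and \<open>y\<close> lie in corresponding open
  intervals of the subdivision, \<open>p\<close> and \<open>q\<close> have the same signs at its points and at infinity, and both
  increase on the interval. The last clause says that \<open>x\<close> and \<open>y\<close> are also in the same position with
  respect to any roots of \<open>p\<close> and \<open>q\<close> that these intervals contain. The aim is
  \<open>gap_same_sign\<close>: then \<open>p\<close> has the same sign at \<open>x\<close> as \<open>q\<close> at \<open>y\<close>.
\<close>

definition gap_data ::
  "('a :: real_closed_field \<times> 'b :: real_closed_field) set \<Rightarrow> 'a poly \<Rightarrow> 'b poly \<Rightarrow> 'a \<Rightarrow> 'b \<Rightarrow> bool"
where
  "gap_data Z p q x y \<longleftrightarrow>
     finite Z \<and> (\<forall>(a, b)\<in>Z. matched Z a b \<and> same_sign (poly p a) (poly q b) \<and> x \<noteq> a) \<and>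
     degree p = degree q \<and> same_sign (lead_coeff p) (lead_coeff q) \<and> matched Z x y \<and>
     (\<forall>t. matched Z t y \<longrightarrow> poly (pderiv p) t > 0) \<and> (\<forall>t. matched Z x t \<longrightarrow> poly (pderiv q) t > 0) \<and>
     (\<forall>r s. matched Z r s \<longrightarrow> poly p r = 0 \<longrightarrow> poly q s = 0 \<longrightarrow> (x < r \<longleftrightarrow> y < s) \<and> (r < x \<longleftrightarrow> s < y))"

lemma gap_data_converse: "gap_data Z p q x y \<Longrightarrow> gap_data (Z\<inverse>) q p y x"
  unfolding gap_data_def
  by (auto simp: matched_converse dest: same_sign_sym matchedD)

text \<open>
  The polynomial \<open>- p (- X)\<close>: reflection in the origin of the plane exchanges left and right but
  preserves increase, so that statements about the right end of an interval also give those about the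
  left end.
\<close>

definition reflect :: "'a :: comm_ring_1 poly \<Rightarrow> 'a poly" where
  "reflect p = - pcompose p [:0, - 1:]"

lemma poly_reflect [simp]: "poly (reflect p) x = - poly p (- x)"
  by (simp add: reflect_def poly_pcompose)

lemma poly_pderiv_reflect [simp]:
  "poly (pderiv (reflect p)) x = poly (pderiv p) (- x)" for p :: "'a :: idom poly"
  by (simp add: reflect_def pderiv_minus pderiv_pcompose poly_pcompose pderiv_pCons)

lemma lead_coeff_reflect:
  "lead_coeff (reflect p) = - (lead_coeff p * (- 1) ^ degree p)" for p :: "'a :: idom poly"
  by (simp add: reflect_def lead_coeff_comp)

lemma degree_reflect [simp]: "degree (reflect p) = degree p" for p :: "'a :: idom poly"
  by (simp add: reflect_def degree_pcompose)

lemma gap_data_reflect: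
  assumes "gap_data Z p q x y"
  shows "gap_data ((\<lambda>(a, b). (- a, - b)) ` Z) (reflect p) (reflect q) (- x) (- y)"
proof -
  let ?Z = "(\<lambda>(a, b). (- a, - b)) ` Z"
  have m: "matched ?Z u v \<longleftrightarrow> matched Z (- u) (- v)" for u v
    unfolding matched_def by (auto simp: minus_less_iff less_minus_iff split: prod.splits)
  have lc: "same_sign (lead_coeff (reflect p)) (lead_coeff (reflect q))"
    using assms unfolding gap_data_def lead_coeff_reflect
    by (auto intro!: same_sign_mult same_sign_power simp: same_sign_def[of "-1"] same_sign_def[of 1])
  have roots: "(- x < r \<longleftrightarrow> - y < s) \<and> (r < - x \<longleftrightarrow> s < - y)"
    if "matched Z (- r) (- s)" "poly p (- r) = 0" "poly q (- s) = 0" for r s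
  proof -
    have "(x < - r \<longleftrightarrow> y < - s) \<and> (- r < x \<longleftrightarrow> - s < y)"
      using assms that unfolding gap_data_def by blast
    then show ?thesis by (simp add: less_minus_iff[of _ x] less_minus_iff[of _ y]
      minus_less_iff[of x] minus_less_iff[of y])
  qed
  show ?thesis
    unfolding gap_data_def m
  proof (intro conjI allI impI)
    show "finite ?Z" "degree (reflect p) = degree (reflect q)"
      "matched Z (- (- x)) (- (- y))"
      using assms by (simp_all add: gap_data_def)
    show "\<forall>(a, b)\<in>?Z. matched Z (- a) (- b) \<and>
        same_sign (poly (reflect p) a) (poly (reflect q) b) \<and> - x \<noteq> a"
      using assms by (auto simp: gap_data_def)
  qed (use assms lc roots in \<open>auto simp: gap_data_def\<close>)
qed

text \<open>
  Since \<open>p\<close> increases, \<open>p x \<ge> 0\<close> makes it positive at the right end of the interval of \<open>x\<close>, where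
  \<open>q\<close> has the same sign. If there is no right end, the leading coefficient takes over this role.
\<close>

lemma gap_increase_right:
  assumes gap: "gap_data Z p q x y" and "poly p x \<ge> 0"
  obtains t where "y < t" "poly q t > 0" "\<And>a b. (a, b) \<in> Z \<Longrightarrow> y < b \<Longrightarrow> t \<le> b"
proof -
  note g = gap[unfolded gap_data_def]
  have inc: "poly p u > 0" if u: "x < u" and *: "\<And>a b. (a, b) \<in> Z \<Longrightarrow> x < a \<Longrightarrow> u \<le> a" for u
  proof -
    have "matched Z t y" if t: "x < t" "t < u" for t
      unfolding matched_def
    proof safe
      fix a b assume ab: "(a, b) \<in> Z"
      have xy: "x < a \<longleftrightarrow> y < b" "a < x \<longleftrightarrow> b < y" "x \<noteq> a" "x < a \<Longrightarrow> u \<le> a"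
        using g ab matchedD[of Z x y a b] * by auto
      show "t < a \<Longrightarrow> y < b" "a < t \<Longrightarrow> b < y" "y < b \<Longrightarrow> t < a" "b < y \<Longrightarrow> a < t"
        using xy t by force+
    qed
    then have "poly p x < poly p u"
      using g u by (intro rcf_strict_increasing) auto
    then show ?thesis using assms(2) by simp
  qed
  define U where "U = {z \<in> Z. x < fst z}"
  have "finite U" using g by (simp add: U_def)
  show ?thesis
  proof (cases "U = {}")
    case True
    then have noZ: "\<not> x < a" if "(a, b) \<in> Z" for a b using that by (force simp: U_def)
    have pos: "poly p u > 0" if "x < u" for u using inc[OF that] noZ by blast
    have "lead_coeff p > 0"
    proof (rule ccontr)
      assume "\<not> ?thesis"
      moreover have "p \<noteq> 0" using pos[of "x + 1"] by auto
      ultimately have "lead_coeff (- p) > 0" by (simp add: not_less order_le_less)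
      then obtain B where "\<And>t. t \<ge> B \<Longrightarrow> poly (- p) t > 0"
        using lead_coeff_pos_imp_eventually_pos by blast
      from this[of "max B (x + 1)"] pos[of "max B (x + 1)"] show False
        by (simp add: less_max_iff_disj)
    qed
    moreover have "same_sign (lead_coeff p) (lead_coeff q)" using g by blast
    ultimately have "lead_coeff q > 0" unfolding same_sign_def by blast
    then obtain B where B: "\<And>t. t \<ge> B \<Longrightarrow> poly q t > 0"
      using lead_coeff_pos_imp_eventually_pos by blast
    show ?thesis
    proof (rule that[of "max B (y + 1)"])
      fix a b assume "(a, b) \<in> Z" "y < b"
      then show "max B (y + 1) \<le> b" using g noZ[of a b] matchedD[of Z x y a b] by auto
    qed (use B in \<open>auto simp: less_max_iff_disj\<close>)
  next
    case False
    define a where "a = Min (fst ` U)"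
    have "a \<in> fst ` U" using False \<open>finite U\<close> unfolding a_def by (intro Min_in) auto
    then obtain b where ab: "(a, b) \<in> Z" "x < a" by (auto simp: U_def)
    have least: "a \<le> a'" if "(a', b') \<in> Z" "x < a'" for a' b'
      unfolding a_def using that \<open>finite U\<close> by (intro Min_le) (force simp: U_def)+
    have "poly p a > 0" using inc[of a] ab least by blast
    then have "poly q b > 0" using g ab by (auto simp: same_sign_def)
    show ?thesis
    proof (rule that[of b])
      show "y < b" using g ab matchedD by blast
      fix a' b' assume *: "(a', b') \<in> Z" "y < b'"
      then have "x < a'" using g matchedD[of Z x y a' b'] by auto
      then have "a \<le> a'" using least * by auto
      then show "b \<le> b'" using g ab * matchedD[of Z a b a' b'] by auto
    qed fact
  qed
qed

lemma gap_decrease_left: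
  assumes gap: "gap_data Z p q x y" and "poly p x \<le> 0"
  obtains t where "t < y" "poly q t < 0" "\<And>a b. (a, b) \<in> Z \<Longrightarrow> b < y \<Longrightarrow> b \<le> t"
proof -
  obtain t where t: "- y < t" "poly (reflect q) t > 0"
    "\<And>a b. (a, b) \<in> (\<lambda>(a, b). (- a, - b)) ` Z \<Longrightarrow> - y < b \<Longrightarrow> t \<le> b"
    using gap_increase_right[OF gap_data_reflect[OF gap]] assms(2) by auto
  show ?thesis
  proof (rule that[of "- t"])
    fix a b assume "(a, b) \<in> Z" "b < y"
    then show "b \<le> - t" using t(3)[of "- a" "- b"] by (force simp: le_minus_iff)
  qed (use t in \<open>auto simp: minus_less_iff\<close>)
qed

text \<open>
  If \<open>p x \<ge> 0\<close> and \<open>q y < 0\<close>, then \<open>q\<close> has a root in the interval to the right of \<open>y\<close>, while \<open>p\<close> has a root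
  at \<open>x\<close> or, from the same argument with the sides exchanged, to the left of \<open>x\<close>. So \<open>x\<close> and \<open>y\<close> are in
  different positions with respect to these roots.
\<close>

lemma gap_nonneg:
  assumes gap: "gap_data Z p q x y" and px: "poly p x \<ge> 0"
  shows "poly q y \<ge> 0"
proof (rule ccontr)
  assume "\<not> ?thesis"
  then have qy: "poly q y < 0" by simp
  note g = gap[unfolded gap_data_def]
  have xy: "x < a \<longleftrightarrow> y < b" "a < x \<longleftrightarrow> b < y" "x \<noteq> a" "y \<noteq> b" if "(a, b) \<in> Z" for a b
    using g that matchedD[of Z x y a b] by auto
  obtain t where t: "y < t" "poly q t > 0" "\<And>a b. (a, b) \<in> Z \<Longrightarrow> y < b \<Longrightarrow> t \<le> b"
    using gap_increase_right[OF gap px] by metis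
  obtain s where s: "y < s" "s < t" "poly q s = 0"
    using rcf_IVT[of y t q] t qy by (auto simp: mult_neg_pos)
  have ys: "y < b \<longleftrightarrow> s < b" "b < y \<longleftrightarrow> b < s" if "(a, b) \<in> Z" for a b
    using xy[OF that] t(3)[OF that] s by auto
  show False
  proof (cases "poly p x = 0")
    case True
    have "matched Z x s" unfolding matched_def using xy ys by blast
    then show False using g True s by blast
  next
    case False
    obtain u where u: "u < x" "poly p u < 0" "\<And>a b. (a, b) \<in> Z \<Longrightarrow> a < x \<Longrightarrow> a \<le> u"
      using gap_decrease_left[OF gap_data_converse[OF gap]] qy by (metis converse_iff order_less_imp_le)
    obtain r where r: "u < r" "r < x" "poly p r = 0"
      using rcf_IVT[of u x p] u px False by (auto simp: mult_neg_pos)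
    have xr: "x < a \<longleftrightarrow> r < a" "a < x \<longleftrightarrow> a < r" if "(a, b) \<in> Z" for a b
      using xy[OF that] u(3)[OF that] r by auto
    have "matched Z r s" unfolding matched_def using xy ys xr by blast
    then show False using g r s by (meson order.asym)
  qed
qed

lemma gap_same_sign:
  assumes gap: "gap_data Z p q x y"
  shows "same_sign (poly p x) (poly q y)"
proof -
  have 1: "poly q y \<ge> 0" if "poly p x \<ge> 0" using gap_nonneg[OF gap that] .
  have 2: "poly q y \<le> 0" if "poly p x \<le> 0"
    using gap_nonneg[OF gap_data_reflect[OF gap]] that by simp
  have 3: "poly p x \<ge> 0" if "poly q y \<ge> 0" using gap_nonneg[OF gap_data_converse[OF gap] that] .
  have 4: "poly p x \<le> 0" if "poly q y \<le> 0"
    using gap_nonneg[OF gap_data_reflect[OF gap_data_converse[OF gap]]] that by simp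
  show ?thesis unfolding same_sign_def using 1 2 3 4 by (meson not_less)
qed

section \<open>Sign tables and the elimination of a variable\<close>

locale coeff_hom =
  fixes \<phi> :: "'c :: comm_ring_1 \<Rightarrow> 'd :: comm_ring_1"
  assumes hom_0 [simp]: "\<phi> 0 = 0" and hom_1 [simp]: "\<phi> 1 = 1"
    and hom_add [simp]: "\<phi> (a + b) = \<phi> a + \<phi> b"
    and hom_mult [simp]: "\<phi> (a * b) = \<phi> a * \<phi> b"
begin

lemma hom_uminus [simp]: "\<phi> (- a) = - \<phi> a"
  using hom_add[of a "- a"] by (simp add: eq_neg_iff_add_eq_0 add.commute)

lemma hom_diff [simp]: "\<phi> (a - b) = \<phi> a - \<phi> b"
  using hom_add[of a "- b"] by simp

lemma hom_power [simp]: "\<phi> (a ^ n) = \<phi> a ^ n"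
  by (induction n) auto

lemma hom_of_nat [simp]: "\<phi> (of_nat n) = of_nat n"
  by (induction n) auto

lemma hom_sum: "\<phi> (sum f A) = (\<Sum>x\<in>A. \<phi> (f x))"
  by (induction A rule: infinite_finite_induct) auto

lemma hom_prod: "\<phi> (prod f A) = (\<Prod>x\<in>A. \<phi> (f x))"
  by (induction A rule: infinite_finite_induct) auto

lemma map_poly_hom_add: "map_poly \<phi> (p + q) = map_poly \<phi> p + map_poly \<phi> q"
  by (rule poly_eqI) (simp add: coeff_map_poly)

lemma map_poly_hom_diff: "map_poly \<phi> (p - q) = map_poly \<phi> p - map_poly \<phi> q"
  by (rule poly_eqI) (simp add: coeff_map_poly)

lemma map_poly_hom_smult: "map_poly \<phi> (smult c p) = smult (\<phi> c) (map_poly \<phi> p)"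
  by (rule poly_eqI) (simp add: coeff_map_poly)

lemma map_poly_hom_mult: "map_poly \<phi> (p * q) = map_poly \<phi> p * map_poly \<phi> q"
  by (rule poly_eqI) (simp add: coeff_map_poly coeff_mult hom_sum)

lemma map_poly_hom_monom: "map_poly \<phi> (monom c n) = monom (\<phi> c) n"
  by (rule poly_eqI) (simp add: coeff_map_poly)

end

text \<open>
  A specialisation of the coefficients may annihilate the leading one; the specialised polynomial is
  then that of the remaining terms.
\<close>

definition drop_lead :: "'c :: comm_ring_1 poly \<Rightarrow> 'c poly" where
  "drop_lead p = p - monom (lead_coeff p) (degree p)"

lemma degree_drop_lead:
  assumes "degree p > 0" shows "degree (drop_lead p) < degree p"
proof -
  have "degree (drop_lead p) \<le> degree p"
    unfolding drop_lead_def by (intro degree_diff_le degree_monom_le order_refl)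
  moreover have "degree (drop_lead p) \<noteq> degree p"
  proof
    assume *: "degree (drop_lead p) = degree p"
    have "coeff (drop_lead p) (degree p) = 0" by (simp add: drop_lead_def)
    then have "drop_lead p = 0" using * by (metis leading_coeff_0_iff)
    then show False using * assms by simp
  qed
  ultimately show ?thesis by simp
qed

text \<open>
  Coefficients will be multivariate polynomials, as elements of a commutative ring without further
  properties, whereas \<open>pderiv\<close> is meant for coefficients without zero divisors.
\<close>

definition formal_deriv :: "'c :: comm_ring_1 poly \<Rightarrow> 'c poly" where
  "formal_deriv p = (\<Sum>i<degree p. monom (of_nat (Suc i) * coeff p (Suc i)) i)"

lemma coeff_formal_deriv: "coeff (formal_deriv p) n = of_nat (Suc n) * coeff p (Suc n)"
  unfolding formal_deriv_def
  by (auto simp: coeff_sum coeff_eq_0 if_distrib cong: if_cong)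

lemma degree_formal_deriv:
  assumes "degree p > 0" shows "degree (formal_deriv p) < degree p"
proof -
  have "degree (formal_deriv p) \<le> degree p - 1"
    by (rule degree_le) (auto simp: coeff_formal_deriv coeff_eq_0)
  then show ?thesis using assms by simp
qed

lemma map_poly_formal_deriv:
  fixes \<phi> :: "'c :: comm_ring_1 \<Rightarrow> 'd :: idom"
  assumes "coeff_hom \<phi>"
  shows "map_poly \<phi> (formal_deriv p) = pderiv (map_poly \<phi> p)"
proof -
  interpret coeff_hom \<phi> by fact
  show ?thesis
    by (rule poly_eqI) (simp add: coeff_map_poly coeff_pderiv coeff_formal_deriv del: of_nat_Suc)
qed

definition pseudo_rem :: "'c :: comm_ring_1 poly \<Rightarrow> 'c poly \<Rightarrow> 'c poly" where
  "pseudo_rem p q = snd (pseudo_divmod p q)"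

lemma pseudo_rem:
  assumes "degree q > 0"
  shows "degree (pseudo_rem p q) < degree q"
    and "\<exists>k s. smult (lead_coeff q ^ k) p = q * s + pseudo_rem p q"
proof -
  obtain s where s: "pseudo_divmod p q = (s, pseudo_rem p q)"
    unfolding pseudo_rem_def by (cases "pseudo_divmod p q") auto
  have "q \<noteq> 0" using assms by auto
  from pseudo_divmod[OF this s]
  show "degree (pseudo_rem p q) < degree q"
    and "\<exists>k s. smult (lead_coeff q ^ k) p = q * s + pseudo_rem p q"
    using assms by (auto simp del: power_Suc)
qed

text \<open>
  The polynomials have coefficients in a ring that is mapped to two real closed fields. The pairs in
  \<open>Z\<close> are corresponding roots. The last clause records of which polynomial they are the roots: reducing
  modulo this polynomial, whose leading coefficient survives both specialisations, yields the sign of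
  a further polynomial at the pair.
\<close>

definition sign_table ::
  "('c :: comm_ring_1 \<Rightarrow> 'a :: real_closed_field) \<Rightarrow> ('c \<Rightarrow> 'b :: real_closed_field) \<Rightarrow>
    ('a \<times> 'b) set \<Rightarrow> 'c poly set \<Rightarrow> bool" where
  "sign_table \<phi> \<psi> Z D \<longleftrightarrow>
     finite Z \<and> (\<forall>(a, b)\<in>Z. matched Z a b) \<and>
     (\<forall>x y. matched Z x y \<longrightarrow> (\<forall>d\<in>D. same_sign (poly (map_poly \<phi> d) x) (poly (map_poly \<psi> d) y))) \<and>
     (\<forall>(a, b)\<in>Z. \<exists>q\<in>D. degree q > 0 \<and> \<phi> (lead_coeff q) \<noteq> 0 \<and>
        same_sign (\<phi> (lead_coeff q)) (\<psi> (lead_coeff q)) \<and>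
        poly (map_poly \<phi> q) a = 0 \<and> poly (map_poly \<psi> q) b = 0)"

lemma sign_table_converse:
  assumes "sign_table \<phi> \<psi> Z D" shows "sign_table \<psi> \<phi> (Z\<inverse>) D"
  unfolding sign_table_def
proof (intro conjI ballI allI impI)
  note t = assms[unfolded sign_table_def]
  show "finite (Z\<inverse>)" using t by simp
  fix z assume "z \<in> Z\<inverse>"
  then obtain a b where ab: "z = (b, a)" "(a, b) \<in> Z" by auto
  show "case z of (x, y) \<Rightarrow> matched (Z\<inverse>) x y" using t ab by (auto simp: matched_converse)
  obtain q where "q \<in> D" "degree q > 0" "\<phi> (lead_coeff q) \<noteq> 0"
    "same_sign (\<phi> (lead_coeff q)) (\<psi> (lead_coeff q))"
    "poly (map_poly \<phi> q) a = 0" "poly (map_poly \<psi> q) b = 0"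
    using t ab(2) by blast
  then show "case z of (x, y) \<Rightarrow> \<exists>q\<in>D. degree q > 0 \<and> \<psi> (lead_coeff q) \<noteq> 0 \<and>
      same_sign (\<psi> (lead_coeff q)) (\<phi> (lead_coeff q)) \<and>
      poly (map_poly \<psi> q) x = 0 \<and> poly (map_poly \<phi> q) y = 0"
    unfolding ab(1) prod.case using same_sign_sym same_sign_eq_0 by metis
next
  fix x y d assume "matched (Z\<inverse>) x y" "d \<in> D"
  then show "same_sign (poly (map_poly \<psi> d) x) (poly (map_poly \<phi> d) y)"
    using assms unfolding sign_table_def matched_converse by (blast intro: same_sign_sym)
qed

lemma gap_neighbourhood:
  fixes Z :: "('a :: linordered_field \<times> 'b :: linordered_field) set"
  assumes "finite Z" "matched Z x y" "\<And>a b. (a, b) \<in> Z \<Longrightarrow> x \<noteq> a"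
  obtains u where "x < u" "\<And>t. x < t \<Longrightarrow> t < u \<Longrightarrow> matched Z t y"
proof -
  define U where "U = fst ` {z \<in> Z. x < fst z}"
  have "finite {x}" "finite U" using assms(1) by (simp_all add: U_def)
  moreover have "s < a" if "s \<in> {x}" "a \<in> U" for s a using that by (auto simp: U_def)
  ultimately obtain u where u: "\<And>s. s \<in> {x} \<Longrightarrow> s < u" "\<And>a. a \<in> U \<Longrightarrow> u < a"
    using between_finite_sets[of "{x}" U] by metis
  show ?thesis
  proof (rule that[of u])
    show "x < u" using u by simp
    fix t assume t: "x < t" "t < u"
    show "matched Z t y" unfolding matched_def
    proof safe
      fix a b assume ab: "(a, b) \<in> Z"
      have "x < a \<longleftrightarrow> y < b" "a < x \<longleftrightarrow> b < y" "x \<noteq> a"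
        using assms(2,3) ab matchedD[of Z x y a b] by auto
      moreover have "u < a" if "x < a" using u(2)[of a] ab that by (force simp: U_def)
      ultimately show "t < a \<Longrightarrow> y < b" "a < t \<Longrightarrow> b < y" "y < b \<Longrightarrow> t < a" "b < y \<Longrightarrow> a < t"
        using t by force+
    qed
  qed
qed

text \<open>
  The sign of the derivative is constant on an interval of the subdivision; were it zero, the
  derivative would have infinitely many roots.
\<close>

lemma sign_table_pderiv_nonzero:
  fixes \<phi> :: "'c :: comm_ring_1 \<Rightarrow> 'a :: real_closed_field" and \<psi> :: "'c \<Rightarrow> 'b :: real_closed_field"
  assumes \<phi>: "coeff_hom \<phi>" and table: "sign_table \<phi> \<psi> Z D" and "formal_deriv p \<in> D"
    and "degree p > 0" "\<phi> (lead_coeff p) \<noteq> 0"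
    and "matched Z x y" "\<And>a b. (a, b) \<in> Z \<Longrightarrow> x \<noteq> a"
  shows "poly (pderiv (map_poly \<phi> p)) x \<noteq> 0"
proof
  interpret coeff_hom \<phi> by fact
  let ?p = "map_poly \<phi> p"
  assume x0: "poly (pderiv ?p) x = 0"
  have same: "same_sign (poly (pderiv ?p) t) (poly (map_poly \<psi> (formal_deriv p)) y)" if "matched Z t y" for t
    using table \<open>formal_deriv p \<in> D\<close> that unfolding sign_table_def map_poly_formal_deriv[OF \<phi>, symmetric] by blast
  obtain u where u: "x < u" "\<And>t. x < t \<Longrightarrow> t < u \<Longrightarrow> matched Z t y"
    using gap_neighbourhood[of Z x y] assms table unfolding sign_table_def by metis
  have "poly (pderiv ?p) t = 0" if "matched Z t y" for t
    using same_sign_eq_0[OF same[OF that]] same_sign_eq_0[OF same[OF assms(6)]] x0 by simp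
  then have "{x<..<u} \<subseteq> {t. poly (pderiv ?p) t = 0}" using u(2) by auto
  moreover have "infinite {x<..<u}" using u(1) by (simp add: infinite_Ioo)
  ultimately have "pderiv ?p = 0" using poly_roots_finite finite_subset by blast
  moreover have "coeff ?p (degree p) \<noteq> 0" using assms(5) by (simp add: coeff_map_poly)
  then have "degree ?p > 0" using assms(4) le_degree[of ?p "degree p"] by simp
  ultimately show False by (simp add: pderiv_eq_0_iff)
qed

text \<open>
  Two roots of \<open>p\<close> are separated by a point of the subdivision, since otherwise Rolle's theorem gives
  a zero of the derivative inside an interval. Hence their order is the same on both sides.
\<close>

lemma sign_table_root_order:
  fixes \<phi> :: "'c :: comm_ring_1 \<Rightarrow> 'a :: real_closed_field" and \<psi> :: "'c \<Rightarrow> 'b :: real_closed_field"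
  assumes \<phi>: "coeff_hom \<phi>" and table: "sign_table \<phi> \<psi> Z D" and pD: "formal_deriv p \<in> D"
    and deg: "degree p > 0" and lc: "\<phi> (lead_coeff p) \<noteq> 0"
    and rs: "matched Z r s" "poly (map_poly \<phi> p) r = 0"
    and rs': "matched Z r' s'" "poly (map_poly \<phi> p) r' = 0"
    and "r < r'"
  shows "s < s'"
proof (rule ccontr)
  assume ge: "\<not> s < s'"
  have sep: "\<not> (r \<le> a \<and> a \<le> r')" if "(a, b) \<in> Z" for a b
    using matchedD[OF rs(1) that] matchedD[OF rs'(1) that] ge \<open>r < r'\<close> by auto
  have gap: "matched Z t s" if t: "r < t" "t < r'" for t
    unfolding matched_def
  proof safe
    fix a b assume ab: "(a, b) \<in> Z"
    have "r < a \<longleftrightarrow> s < b" "a < r \<longleftrightarrow> b < s"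
      using matchedD[OF rs(1) ab] by auto
    moreover have "r < a \<longleftrightarrow> t < a" "a < r \<longleftrightarrow> a < t"
      using sep[OF ab] t by (meson not_less less_trans less_le_trans le_less_trans less_imp_le)+
    ultimately show "t < a \<Longrightarrow> s < b" "a < t \<Longrightarrow> b < s" "s < b \<Longrightarrow> t < a" "b < s \<Longrightarrow> a < t"
      by blast+
  qed
  obtain c where c: "r < c" "c < r'" "poly (pderiv (map_poly \<phi> p)) c = 0"
    using rcf_rolle[OF \<open>r < r'\<close> rs(2) rs'(2)] by blast
  then show False
    using sign_table_pderiv_nonzero[OF \<phi> table pD deg lc, of c s] gap[of c]
      sep order.strict_implies_order by metis
qed

text \<open>
  All pairs of roots of \<open>p\<close> in corresponding positions are added to the table. That every new root
  on one side has a partner on the other is then a consequence of the equality of signs.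
\<close>

lemma sign_table_insert:
  fixes \<phi> :: "'c :: comm_ring_1 \<Rightarrow> 'a :: real_closed_field" and \<psi> :: "'c \<Rightarrow> 'b :: real_closed_field"
  assumes \<phi>: "coeff_hom \<phi>" and \<psi>: "coeff_hom \<psi>" and table: "sign_table \<phi> \<psi> Z D"
    and deg: "degree p > 0"
    and trunc: "drop_lead p \<in> D" and pD: "formal_deriv p \<in> D" and lc: "[:lead_coeff p:] \<in> D"
    and rem: "\<And>q. q \<in> D \<Longrightarrow> degree q > 0 \<Longrightarrow> pseudo_rem p q \<in> D"
  shows "\<exists>Z'. sign_table \<phi> \<psi> Z' (insert p D)"
proof -
  interpret \<phi>: coeff_hom \<phi> by fact
  interpret \<psi>: coeff_hom \<psi> by fact
  let ?p = "map_poly \<phi> p" and ?q = "map_poly \<psi> p"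
  have fin: "finite Z" and compat: "\<And>a b. (a, b) \<in> Z \<Longrightarrow> matched Z a b"
    and signs: "\<And>x y d. matched Z x y \<Longrightarrow> d \<in> D \<Longrightarrow>
      same_sign (poly (map_poly \<phi> d) x) (poly (map_poly \<psi> d) y)"
    using table unfolding sign_table_def by auto
  have lc_sign: "same_sign (\<phi> (lead_coeff p)) (\<psi> (lead_coeff p))"
  proof -
    obtain y where "matched Z 0 y" using matched_partner[OF fin compat] by blast
    from signs[OF this lc] show ?thesis by (simp add: map_poly_pCons)
  qed
  show ?thesis
  proof (cases "\<phi> (lead_coeff p) = 0")
    case True
    then have "\<psi> (lead_coeff p) = 0" using same_sign_eq_0[OF lc_sign] by simp
    then have "map_poly \<phi> (drop_lead p) = ?p" "map_poly \<psi> (drop_lead p) = ?q"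
      using True by (simp_all add: drop_lead_def \<phi>.map_poly_hom_diff \<psi>.map_poly_hom_diff
          \<phi>.map_poly_hom_monom \<psi>.map_poly_hom_monom)
    then have "same_sign (poly ?p x) (poly ?q y)" if "matched Z x y" for x y
      using signs[OF that trunc] by simp
    then have "sign_table \<phi> \<psi> Z (insert p D)"
      using table unfolding sign_table_def by fast
    then show ?thesis ..
  next
    case lc\<phi>: False
    then have lc\<psi>: "\<psi> (lead_coeff p) \<noteq> 0" using same_sign_eq_0[OF lc_sign] by simp
    have degs: "degree ?p = degree p" "degree ?q = degree p"
      using lc\<phi> lc\<psi> by (auto intro!: antisym map_poly_degree_leq le_degree simp: coeff_map_poly)
    have lcs: "lead_coeff ?p = \<phi> (lead_coeff p)" "lead_coeff ?q = \<psi> (lead_coeff p)"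
      by (simp_all add: degs) (simp_all add: coeff_map_poly)
    \<comment> \<open>At a common root of \<open>q\<close>, up to a power of the leading coefficient of \<open>q\<close>, the value of \<open>p\<close> is that
      of its remainder.\<close>
    have at_Z: "same_sign (poly ?p a) (poly ?q b)" if ab: "(a, b) \<in> Z" for a b
    proof -
      obtain q where q: "q \<in> D" "degree q > 0" "\<phi> (lead_coeff q) \<noteq> 0"
        "same_sign (\<phi> (lead_coeff q)) (\<psi> (lead_coeff q))"
        "poly (map_poly \<phi> q) a = 0" "poly (map_poly \<psi> q) b = 0"
        using table ab unfolding sign_table_def by blast
      obtain k s where ks: "smult (lead_coeff q ^ k) p = q * s + pseudo_rem p q"
        using pseudo_rem(2)[OF q(2)] by blast
      have "\<phi> (lead_coeff q) ^ k * poly ?p a = poly (map_poly \<phi> (pseudo_rem p q)) a"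
        using arg_cong[OF ks, of "\<lambda>f. poly (map_poly \<phi> f) a"] q(5)
        by (simp add: \<phi>.map_poly_hom_add \<phi>.map_poly_hom_mult \<phi>.map_poly_hom_smult)
      moreover have "\<psi> (lead_coeff q) ^ k * poly ?q b = poly (map_poly \<psi> (pseudo_rem p q)) b"
        using arg_cong[OF ks, of "\<lambda>f. poly (map_poly \<psi> f) b"] q(6)
        by (simp add: \<psi>.map_poly_hom_add \<psi>.map_poly_hom_mult \<psi>.map_poly_hom_smult)
      ultimately have "same_sign (\<phi> (lead_coeff q) ^ k * poly ?p a) (\<psi> (lead_coeff q) ^ k * poly ?q b)"
        using signs[OF compat[OF ab] rem[OF q(1,2)]] by simp
      then show ?thesis using same_sign_mult_cancel same_sign_power[OF q(4)] q(3)
        by (metis power_not_zero)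
    qed
    \<comment> \<open>Not every pair of roots will do: the position with respect to the old points decides which
      roots belong together.\<close>
    define Z' where "Z' = Z \<union> {(r, s). matched Z r s \<and> poly ?p r = 0 \<and> poly ?q s = 0}"
    have Z': "matched Z x y" if "matched Z' x y" for x y
      using that unfolding Z'_def matched_def by blast
    have nz: "?p \<noteq> 0" "?q \<noteq> 0" using lcs lc\<phi> lc\<psi> by auto
    have fin': "finite Z'"
      by (rule finite_subset[of _ "Z \<union> {r. poly ?p r = 0} \<times> {s. poly ?q s = 0}"])
        (use fin poly_roots_finite[OF nz(1)] poly_roots_finite[OF nz(2)] in \<open>auto simp: Z'_def\<close>)
    have root_order: "r < r' \<longleftrightarrow> s < s'"
      if "matched Z r s" "poly ?p r = 0" "poly ?q s = 0"
        and "matched Z r' s'" "poly ?p r' = 0" "poly ?q s' = 0" for r s r' s'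
    proof
      assume "r < r'"
      then show "s < s'" using sign_table_root_order[OF \<phi> table pD deg lc\<phi>] that by blast
    next
      assume "s < s'"
      then show "r < r'"
        using sign_table_root_order[OF \<psi> sign_table_converse[OF table] pD deg lc\<psi>] that
        by (auto simp: matched_converse)
    qed
    have compat': "matched Z' r s" if rs: "(r, s) \<in> Z'" for r s
      unfolding matched_def
    proof safe
      fix a b assume ab: "(a, b) \<in> Z'"
      have *: "(r < a \<longleftrightarrow> s < b) \<and> (a < r \<longleftrightarrow> b < s)"
      proof (cases "(a, b) \<in> Z")
        case True
        have "matched Z r s" using rs compat by (auto simp: Z'_def)
        then show ?thesis using matchedD True by blast
      next
        case False
        then have ab': "matched Z a b" "poly ?p a = 0" "poly ?q b = 0" using ab by (auto simp: Z'_def)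
        show ?thesis
        proof (cases "(r, s) \<in> Z")
          case True
          then show ?thesis using matchedD[OF ab'(1)] by blast
        next
          case False
          then have "matched Z r s" "poly ?p r = 0" "poly ?q s = 0" using rs by (auto simp: Z'_def)
          then show ?thesis using root_order ab' by blast
        qed
      qed
      then show "r < a \<Longrightarrow> s < b" "a < r \<Longrightarrow> b < s" "s < b \<Longrightarrow> r < a" "b < s \<Longrightarrow> a < r" by blast+
    qed
    have p_sign: "same_sign (poly ?p x) (poly ?q y)" if xy': "matched Z' x y" for x y
    proof (cases "\<exists>b. (x, b) \<in> Z")
      case True
      then obtain b where b: "(x, b) \<in> Z" by blast
      then have "y = b" using matchedD(3)[OF Z'[OF xy']] by blast
      then show ?thesis using at_Z b by simp
    next
      case False
      then have out: "x \<noteq> a" if "(a, b) \<in> Z" for a b using that by blast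
      have xy: "matched Z x y" using Z'[OF xy'] .
      let ?d = "poly (pderiv ?p) x"
      have "?d \<noteq> 0" using sign_table_pderiv_nonzero[OF \<phi> table pD deg lc\<phi> xy] out by blast
      have d: "same_sign (poly (pderiv ?p) t) (poly (pderiv ?q) u)" if "matched Z t u" for t u
        using signs[OF that pD] by (simp add: map_poly_formal_deriv[OF \<phi>] map_poly_formal_deriv[OF \<psi>])
      have roots: "(x < r \<longleftrightarrow> y < s) \<and> (r < x \<longleftrightarrow> s < y)"
        if "matched Z r s" "poly ?p r = 0" "poly ?q s = 0" for r s
      proof -
        have "(r, s) \<in> Z'" using that by (simp add: Z'_def)
        then show ?thesis using matchedD[OF xy'] by blast
      qed
      show ?thesis
      proof (cases "?d > 0")
        case xd: True
        have yd: "poly (pderiv ?q) y > 0" using d[OF xy] xd by (simp add: same_sign_def)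
        have at: "\<forall>(a, b)\<in>Z. matched Z a b \<and> same_sign (poly (?p) a) (poly (?q) b) \<and> x \<noteq> a"
          using compat at_Z out by blast
        have dp: "poly (pderiv (?p)) t > 0" if "matched Z t y" for t
          using d[OF that] yd by (simp add: same_sign_def)
        have dq: "poly (pderiv (?q)) t > 0" if "matched Z x t" for t
          using d[OF that] xd by (simp add: same_sign_def)
        have "gap_data Z (?p) (?q) x y"
          unfolding gap_data_def using fin at lcs lc_sign degs xy dp dq roots by simp
        then show ?thesis by (rule gap_same_sign)
      next
        case False
        then have xd: "?d < 0" using \<open>?d \<noteq> 0\<close> by simp
        have yd: "poly (pderiv ?q) y < 0" using d[OF xy] xd by (simp add: same_sign_def)
        have at: "\<forall>(a, b)\<in>Z. matched Z a b \<and> same_sign (poly (- ?p) a) (poly (- ?q) b) \<and> x \<noteq> a"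
          unfolding poly_minus same_sign_minus using compat at_Z out by blast
        have dp: "poly (pderiv (- ?p)) t > 0" if "matched Z t y" for t
          using d[OF that] yd by (simp add: same_sign_def pderiv_minus)
        have dq: "poly (pderiv (- ?q)) t > 0" if "matched Z x t" for t
          using d[OF that] xd by (simp add: same_sign_def pderiv_minus)
        have "gap_data Z (- ?p) (- ?q) x y"
          unfolding gap_data_def using fin at lcs lc_sign degs xy dp dq roots by simp
        then show ?thesis using gap_same_sign by fastforce
      qed
    qed
    have "sign_table \<phi> \<psi> Z' (insert p D)"
      unfolding sign_table_def
    proof (intro conjI allI impI ballI)
      show "finite Z'" by fact
      show "case z of (a, b) \<Rightarrow> matched Z' a b" if "z \<in> Z'" for z using that compat' by auto
      show "same_sign (poly (map_poly \<phi> d) x) (poly (map_poly \<psi> d) y)"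
        if "matched Z' x y" "d \<in> insert p D" for x y d
        using that p_sign signs[OF Z'] by auto
      fix z assume z: "z \<in> Z'"
      obtain a b where ab: "z = (a, b)" by fastforce
      show "case z of (a, b) \<Rightarrow> \<exists>q\<in>insert p D. degree q > 0 \<and> \<phi> (lead_coeff q) \<noteq> 0 \<and>
        same_sign (\<phi> (lead_coeff q)) (\<psi> (lead_coeff q)) \<and>
        poly (map_poly \<phi> q) a = 0 \<and> poly (map_poly \<psi> q) b = 0"
      proof (cases "(a, b) \<in> Z")
        case True
        then show ?thesis using table ab unfolding sign_table_def by blast
      next
        case False
        then show ?thesis using z ab deg lc\<phi> lc_sign by (auto simp: Z'_def)
      qed
    qed
    then show ?thesis ..
  qed
qed

text \<open>
  Each operation on polynomials of the set is indexed by the degree of the polynomial it depends on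
  (the divisor, in the case of a pseudo-remainder) and its result has smaller degree. So the closure
  is reached by treating these degrees in decreasing order, and it remains finite.
\<close>

definition saturated_from :: "nat \<Rightarrow> 'c :: comm_ring_1 poly set \<Rightarrow> bool" where
  "saturated_from n D \<longleftrightarrow>
     (\<forall>p\<in>D. n \<le> degree p \<longrightarrow> degree p > 0 \<longrightarrow>
        drop_lead p \<in> D \<and> formal_deriv p \<in> D \<and> [:lead_coeff p:] \<in> D) \<and>
     (\<forall>p\<in>D. \<forall>q\<in>D. n \<le> degree q \<longrightarrow> degree q > 0 \<longrightarrow> degree q \<le> degree p \<longrightarrow> pseudo_rem p q \<in> D)"

lemma saturate_step:
  assumes "finite D" "saturated_from (Suc n) D"
  shows "\<exists>D'. D \<subseteq> D' \<and> finite D' \<and> saturated_from n D'"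
proof (cases "n = 0")
  case True
  then show ?thesis using assms by (auto simp: saturated_from_def Suc_le_eq)
next
  case n: False
  \<comment> \<open>All results have degree below \<open>n\<close>, so no new operations of index \<open>n\<close> or more arise from them.\<close>
  define Dn where "Dn = {p \<in> D. degree p = n}"
  define N where "N = drop_lead ` Dn \<union> formal_deriv ` Dn \<union> (\<lambda>p. [:lead_coeff p:]) ` Dn \<union>
    (\<lambda>(p, q). pseudo_rem p q) ` (D \<times> Dn)"
  have small: "degree r < n" if "r \<in> N" for r
    using that n degree_drop_lead degree_formal_deriv pseudo_rem(1) unfolding N_def Dn_def by auto
  have old: "p \<in> D" if "p \<in> D \<union> N" "n \<le> degree p" for p using that small by force
  have "saturated_from n (D \<union> N)"
    unfolding saturated_from_def
  proof (intro conjI ballI impI)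
    fix p assume p: "p \<in> D \<union> N" "n \<le> degree p" "degree p > 0"
    have *: "p \<in> D" using old p by blast
    have "drop_lead p \<in> D \<union> N \<and> formal_deriv p \<in> D \<union> N \<and> [:lead_coeff p:] \<in> D \<union> N"
    proof (cases "degree p = n")
      case True
      then show ?thesis using * by (auto simp: N_def Dn_def)
    next
      case False
      then show ?thesis using * p assms(2) by (auto simp: saturated_from_def)
    qed
    then show "drop_lead p \<in> D \<union> N" "formal_deriv p \<in> D \<union> N" "[:lead_coeff p:] \<in> D \<union> N" by blast+
  next
    fix p q assume pq: "p \<in> D \<union> N" "q \<in> D \<union> N" "n \<le> degree q" "degree q > 0" "degree q \<le> degree p"
    have *: "p \<in> D" "q \<in> D"
      using old[OF pq(1) le_trans[OF pq(3,5)]] old[OF pq(2,3)] by auto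
    show "pseudo_rem p q \<in> D \<union> N"
    proof (cases "degree q = n")
      case True
      then show ?thesis using * by (force simp: N_def Dn_def)
    next
      case False
      then show ?thesis using * pq assms(2) by (auto simp: saturated_from_def)
    qed
  qed
  moreover have "finite (D \<union> N)" using assms(1) by (auto simp: N_def Dn_def)
  ultimately show ?thesis by blast
qed

lemma saturation_exists:
  assumes "finite D"
  shows "\<exists>D'. D \<subseteq> D' \<and> finite D' \<and> saturated_from 0 D'"
proof -
  define N where "N = Suc (Max (insert 0 (degree ` D)))"
  have N: "degree p < N" if "p \<in> D" for p
    using that assms by (simp add: N_def less_Suc_eq_le)
  have "\<exists>D'. D \<subseteq> D' \<and> finite D' \<and> saturated_from n D'" if "n \<le> N" for n
    using that
  proof (induction n rule: inc_induct)
    case base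
    have "saturated_from N D" using N by (force simp: saturated_from_def)
    then show ?case using assms by blast
  next
    case (step n)
    then obtain D' where "D \<subseteq> D'" "finite D'" "saturated_from (Suc n) D'" by blast
    then show ?case using saturate_step[of D' n] by blast
  qed
  then show ?thesis by blast
qed

lemma sign_table_exists:
  fixes \<phi> :: "'c :: comm_ring_1 \<Rightarrow> 'a :: real_closed_field" and \<psi> :: "'c \<Rightarrow> 'b :: real_closed_field"
  assumes \<phi>: "coeff_hom \<phi>" and \<psi>: "coeff_hom \<psi>"
    and D: "finite D" "saturated_from 0 D"
    and const: "\<And>d. d \<in> D \<Longrightarrow> degree d = 0 \<Longrightarrow> same_sign (\<phi> (coeff d 0)) (\<psi> (coeff d 0))"
  shows "\<exists>Z. sign_table \<phi> \<psi> Z D"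
proof -
  interpret \<phi>: coeff_hom \<phi> by fact
  interpret \<psi>: coeff_hom \<psi> by fact
  have "\<exists>Z. sign_table \<phi> \<psi> Z {d \<in> D. degree d < Suc n}" for n
  proof (induction n)
    case 0
    have "same_sign (poly (map_poly \<phi> d) x) (poly (map_poly \<psi> d) y)"
      if d: "d \<in> D" "degree d = 0" for d x y
    proof -
      obtain c where "d = [:c:]" using d(2) degree_eq_zeroE by blast
      then show ?thesis using const[OF d] by (simp add: map_poly_pCons)
    qed
    then have "sign_table \<phi> \<psi> {} {d \<in> D. degree d < Suc 0}" by (auto simp: sign_table_def)
    then show ?case ..
  next
    case (Suc n)
    have "\<exists>Z. sign_table \<phi> \<psi> Z ({d \<in> D. degree d < Suc n} \<union> S)"
      if "finite S" "S \<subseteq> {d \<in> D. degree d = Suc n}" for S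
      using that
    proof (induction S rule: finite_induct)
      case empty
      then show ?case using Suc by simp
    next
      case (insert p S)
      then obtain Z where Z: "sign_table \<phi> \<psi> Z ({d \<in> D. degree d < Suc n} \<union> S)" by blast
      have p: "p \<in> D" "degree p = Suc n" using insert by auto
      have sat: "drop_lead p \<in> D" "formal_deriv p \<in> D" "[:lead_coeff p:] \<in> D"
        "\<And>q. q \<in> D \<Longrightarrow> degree q > 0 \<Longrightarrow> degree q \<le> degree p \<Longrightarrow> pseudo_rem p q \<in> D"
        using D(2) p by (auto simp: saturated_from_def)
      have "\<exists>Z'. sign_table \<phi> \<psi> Z' (Set.insert p ({d \<in> D. degree d < Suc n} \<union> S))"
      proof (rule sign_table_insert[OF \<phi> \<psi> Z])
        show "degree p > 0" using p by simp
        show "drop_lead p \<in> {d \<in> D. degree d < Suc n} \<union> S"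
          using sat p degree_drop_lead[of p] by auto
        show "formal_deriv p \<in> {d \<in> D. degree d < Suc n} \<union> S"
          using sat p degree_formal_deriv[of p] by auto
        show "[:lead_coeff p:] \<in> {d \<in> D. degree d < Suc n} \<union> S"
          using sat by auto
        fix q assume q: "q \<in> {d \<in> D. degree d < Suc n} \<union> S" "degree q > 0"
        then have "q \<in> D" "degree q \<le> Suc n" using insert by auto
        then show "pseudo_rem p q \<in> {d \<in> D. degree d < Suc n} \<union> S"
          using sat(4)[of q] p q pseudo_rem(1)[of q p] by auto
      qed
      then show ?case by simp
    qed
    from this[of "{d \<in> D. degree d = Suc n}"]
    have "\<exists>Z. sign_table \<phi> \<psi> Z ({d \<in> D. degree d < Suc n} \<union> {d \<in> D. degree d = Suc n})"
      using D(1) by simp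
    also have "{d \<in> D. degree d < Suc n} \<union> {d \<in> D. degree d = Suc n} = {d \<in> D. degree d < Suc (Suc n)}"
      by auto
    finally show ?case .
  qed
  from this[of "Max (insert 0 (degree ` D))"]
  have "\<exists>Z. sign_table \<phi> \<psi> Z {d \<in> D. degree d < Suc (Max (insert 0 (degree ` D)))}" .
  also have "{d \<in> D. degree d < Suc (Max (insert 0 (degree ` D)))} = D"
    using D(1) by (auto simp: less_Suc_eq_le)
  finally show ?thesis .
qed

text \<open>
  The constants of the saturated set play the role of the quantifier-free condition on the coefficients
  that a quantifier elimination would produce.
\<close>

theorem eliminate_variable:
  fixes D :: "'c :: comm_ring_1 poly set"
  assumes "finite D"
  obtains E :: "'c set" where "finite E"
    and "\<And>(\<phi> :: 'c \<Rightarrow> 'a :: real_closed_field) (\<psi> :: 'c \<Rightarrow> 'b :: real_closed_field) x.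
      coeff_hom \<phi> \<Longrightarrow> coeff_hom \<psi> \<Longrightarrow> (\<And>e. e \<in> E \<Longrightarrow> same_sign (\<phi> e) (\<psi> e)) \<Longrightarrow>
      \<exists>y. \<forall>d\<in>D. same_sign (poly (map_poly \<phi> d) x) (poly (map_poly \<psi> d) y)"
proof -
  obtain D' where D': "D \<subseteq> D'" "finite D'" "saturated_from 0 D'"
    using saturation_exists[OF assms] by blast
  show ?thesis
  proof (rule that[of "(\<lambda>d. coeff d 0) ` D'"])
    show "finite ((\<lambda>d. coeff d 0) ` D')" using D' by simp
    fix \<phi> :: "'c \<Rightarrow> 'a" and \<psi> :: "'c \<Rightarrow> 'b" and x
    assume h: "coeff_hom \<phi>" "coeff_hom \<psi>"
      "\<And>e. e \<in> (\<lambda>d. coeff d 0) ` D' \<Longrightarrow> same_sign (\<phi> e) (\<psi> e)"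
    obtain Z where Z: "sign_table \<phi> \<psi> Z D'"
      using sign_table_exists[OF h(1,2) D'(2,3)] h(3) by blast
    obtain y where "matched Z x y"
      using matched_partner[of Z] Z unfolding sign_table_def by blast
    then show "\<exists>y. \<forall>d\<in>D. same_sign (poly (map_poly \<phi> d) x) (poly (map_poly \<psi> d) y)"
      using Z D'(1) unfolding sign_table_def by blast
  qed
qed

section \<open>Transfer of solvability between real closed fields\<close>

text \<open>
  The coordinates may lie in another ring than the coefficients, so that the same polynomial can be
  evaluated over each of the two fields that are compared.
\<close>

definition eval_via :: "('a :: comm_ring_1 \<Rightarrow> 'b :: comm_ring_1) \<Rightarrow> ('n :: finite \<Rightarrow> 'b) \<Rightarrow> ('n, 'a) mpoly \<Rightarrow> 'b" where
  "eval_via \<iota> u p = (\<Sum>a\<in>Poly_Mapping.keys p.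
     \<iota> (Poly_Mapping.lookup p a) * (\<Prod>i\<in>UNIV. u i ^ Poly_Mapping.lookup a i))"

lemma mp_eval_eq_eval_via: "mp_eval x p = eval_via (\<lambda>c. c) (($) x) p"
  by (simp add: mp_eval_def eval_via_def)

lemma poly_mapping_sum_single:
  "p = (\<Sum>a\<in>Poly_Mapping.keys p. Poly_Mapping.single a (Poly_Mapping.lookup p a))"
  by (rule poly_mapping_eqI)
    (auto simp: lookup_sum lookup_single when_def in_keys_iff)

context
  fixes \<iota> :: "'a :: comm_ring_1 \<Rightarrow> 'b :: comm_ring_1"
  assumes \<iota>: "coeff_hom \<iota>"
begin

interpretation \<iota>: coeff_hom \<iota> by (rule \<iota>)

lemma eval_via_superset:
  assumes "finite A" "Poly_Mapping.keys p \<subseteq> A"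
  shows "eval_via \<iota> u p = (\<Sum>a\<in>A. \<iota> (Poly_Mapping.lookup p a) * (\<Prod>i\<in>UNIV. u i ^ Poly_Mapping.lookup a i))"
  unfolding eval_via_def using assms
  by (intro sum.mono_neutral_left) (auto simp: in_keys_iff)

lemma eval_via_0: "eval_via \<iota> u 0 = 0"
  by (simp add: eval_via_def)

lemma eval_via_single: "eval_via \<iota> u (Poly_Mapping.single a c) = \<iota> c * (\<Prod>i\<in>UNIV. u i ^ Poly_Mapping.lookup a i)"
  by (subst eval_via_superset[of "{a}"]) auto

lemma eval_via_add: "eval_via \<iota> u (p + q) = eval_via \<iota> u p + eval_via \<iota> u q"
proof -
  let ?A = "Poly_Mapping.keys p \<union> Poly_Mapping.keys q"
  have "Poly_Mapping.keys (p + q) \<subseteq> ?A" by (rule Poly_Mapping.keys_add)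
  then show ?thesis
    by (subst (1 2 3) eval_via_superset[of ?A])
      (auto simp: lookup_add distrib_right sum.distrib)
qed

lemma eval_via_sum: "eval_via \<iota> u (sum f A) = (\<Sum>x\<in>A. eval_via \<iota> u (f x))"
  by (induction A rule: infinite_finite_induct) (auto simp: eval_via_0 eval_via_add)

lemma eval_via_mult: "eval_via \<iota> u (p * q) = eval_via \<iota> u p * eval_via \<iota> u q"
proof -
  have single: "eval_via \<iota> u (Poly_Mapping.single a c * Poly_Mapping.single b d) =
      eval_via \<iota> u (Poly_Mapping.single a c) * eval_via \<iota> u (Poly_Mapping.single b d)" for a b c d
    unfolding mult_single eval_via_single lookup_add power_add prod.distrib \<iota>.hom_mult
    by (simp only: mult_ac)
  have "eval_via \<iota> u (p * q) = eval_via \<iota> u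
      ((\<Sum>a\<in>Poly_Mapping.keys p. Poly_Mapping.single a (Poly_Mapping.lookup p a)) *
       (\<Sum>b\<in>Poly_Mapping.keys q. Poly_Mapping.single b (Poly_Mapping.lookup q b)))"
    by (simp only: poly_mapping_sum_single[symmetric])
  also have "\<dots> = eval_via \<iota> u (\<Sum>a\<in>Poly_Mapping.keys p. Poly_Mapping.single a (Poly_Mapping.lookup p a)) *
       eval_via \<iota> u (\<Sum>b\<in>Poly_Mapping.keys q. Poly_Mapping.single b (Poly_Mapping.lookup q b))"
    by (simp add: sum_product eval_via_sum single)
  finally show ?thesis
    by (simp only: poly_mapping_sum_single[symmetric])
qed

lemma coeff_hom_eval_via: "coeff_hom (eval_via \<iota> u)"
proof
  show "eval_via \<iota> u 1 = 1"
    using eval_via_single[of u 0 1] by simp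
qed (simp_all add: eval_via_0 eval_via_add eval_via_mult)

end

text \<open>
  A multivariate polynomial as a polynomial in the variable \<open>i\<close>, with coefficients that do not contain
  this variable.
\<close>

definition poly_in :: "'n :: finite \<Rightarrow> ('n, 'a :: comm_ring_1) mpoly \<Rightarrow> ('n, 'a) mpoly poly" where
  "poly_in i p = (\<Sum>a\<in>Poly_Mapping.keys p.
     monom (Poly_Mapping.single (Poly_Mapping.update i 0 a) (Poly_Mapping.lookup p a)) (Poly_Mapping.lookup a i))"

lemma poly_poly_in:
  fixes \<iota> :: "'a :: comm_ring_1 \<Rightarrow> 'b :: comm_ring_1" and u :: "'n :: finite \<Rightarrow> 'b"
  assumes "coeff_hom \<iota>"
  shows "poly (map_poly (eval_via \<iota> u) (poly_in i p)) t = eval_via \<iota> (u(i := t)) p"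
proof -
  interpret E: coeff_hom "eval_via \<iota> u" by (rule coeff_hom_eval_via[OF assms])
  have map_sum: "map_poly (eval_via \<iota> u) (sum f A) = (\<Sum>x\<in>A. map_poly (eval_via \<iota> u) (f x))"
    for f :: "('n \<Rightarrow>\<^sub>0 nat) \<Rightarrow> _" and A
    by (induction A rule: infinite_finite_induct) (auto simp: E.map_poly_hom_add)
  have mon: "(\<Prod>j\<in>UNIV. u j ^ Poly_Mapping.lookup (Poly_Mapping.update i 0 a) j) * t ^ Poly_Mapping.lookup a i =
     (\<Prod>j\<in>UNIV. (u(i := t)) j ^ Poly_Mapping.lookup a j)" for a :: "'n \<Rightarrow>\<^sub>0 nat"
  proof -
    have "(\<Prod>j\<in>UNIV. u j ^ Poly_Mapping.lookup (Poly_Mapping.update i 0 a) j) =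
        (\<Prod>j\<in>UNIV - {i}. u j ^ Poly_Mapping.lookup a j)"
      by (subst prod.remove[of _ i]) (auto simp: lookup_update intro!: prod.cong)
    moreover have "(\<Prod>j\<in>UNIV. (u(i := t)) j ^ Poly_Mapping.lookup a j) =
        t ^ Poly_Mapping.lookup a i * (\<Prod>j\<in>UNIV - {i}. u j ^ Poly_Mapping.lookup a j)"
      by (subst prod.remove[of _ i]) (auto intro!: prod.cong)
    ultimately show ?thesis by (simp add: mult.commute)
  qed
  show ?thesis
    unfolding poly_in_def map_sum E.map_poly_hom_monom poly_sum poly_monom eval_via_single[OF assms] mult.assoc mon
    by (simp add: eval_via_def)
qed

lemma rcf_pos_is_square:
  fixes r :: "'a :: real_closed_field"
  assumes "r > 0" obtains s where "r = s * s" "s \<noteq> 0"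
proof -
  \<comment> \<open>The polynomial \<open>X\<^sup>2 - r\<close> changes sign between \<open>0\<close> and \<open>r + 1\<close>.\<close>
  have "(r + 1) * (r + 1) - r > 0"
    using assms by (simp add: algebra_simps add_pos_pos)
  then have "poly [:- r, 0, 1:] 0 * poly [:- r, 0, 1:] (r + 1) < 0"
    using assms by (intro mult_neg_pos) (auto simp: algebra_simps)
  moreover have "0 < r + 1" using assms by (simp add: add_pos_pos)
  ultimately obtain s where "poly [:- r, 0, 1:] s = 0" using rcf_IVT by blast
  then have "r = s * s" by simp
  moreover from this have "s \<noteq> 0" using assms by auto
  ultimately show ?thesis by (rule that)
qed

text \<open>
  In a real closed field the order is determined by the multiplication, as the nonnegative elements
  are the squares; so field homomorphisms preserve it.
\<close>

lemma hom_same_sign: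
  fixes \<iota> :: "'a :: real_closed_field \<Rightarrow> 'b :: real_closed_field"
  assumes "coeff_hom \<iota>"
  shows "same_sign (\<iota> r) r"
proof -
  interpret coeff_hom \<iota> by fact
  have pos: "\<iota> r > 0" if r: "r > 0" for r
  proof -
    obtain s where s: "r = s * s" "s \<noteq> 0" using rcf_pos_is_square[OF r] by blast
    have "\<iota> s * \<iota> (1 / s) = 1" using s(2) by (simp flip: hom_mult)
    then have "\<iota> s \<noteq> 0" by auto
    then show ?thesis using s(1) by (simp add: zero_less_mult_iff) (metis neq_iff)
  qed
  consider "r > 0" | "r = 0" | "r < 0" by fastforce
  then show ?thesis
  proof cases
    case 3
    then show ?thesis using pos[of "- r"] by (simp add: same_sign_def)
  qed (use pos[of r] in \<open>auto simp: same_sign_def\<close>)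
qed

text \<open>
  Induction on the set \<open>S\<close> of the variables that have been specialised to the coordinates of \<open>u\<close>, the others
  being zero. To pass to one more variable, the coefficients of the polynomials in this variable are
  handled by the induction hypothesis and the variable itself by elimination.
\<close>

lemma transfer_signs:
  fixes \<iota> :: "'a :: real_closed_field \<Rightarrow> 'b :: real_closed_field"
    and u :: "'n :: finite \<Rightarrow> 'b"
  assumes \<iota>: "coeff_hom \<iota>" and "finite S" "finite D"
  shows "\<exists>v. \<forall>d\<in>D. same_sign (eval_via \<iota> (\<lambda>i. if i \<in> S then u i else 0) d) (eval_via (\<lambda>c. c) v d)"
  using assms(2,3)
proof (induction S arbitrary: D rule: finite_induct)
  case empty
  have id: "coeff_hom (\<lambda>c :: 'a. c)" by standard auto
  have ev: "eval_via f (\<lambda>_. 0) d = f (Poly_Mapping.lookup d 0)"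
    if f: "coeff_hom f" for f :: "'a \<Rightarrow> 'c :: real_closed_field" and d :: "('n, 'a) mpoly"
  proof -
    interpret coeff_hom f by fact
    have z: "(\<Prod>i\<in>UNIV. (0 :: 'c) ^ Poly_Mapping.lookup a i) = 0" if a: "a \<noteq> 0" for a :: "'n \<Rightarrow>\<^sub>0 nat"
    proof -
      obtain i where "Poly_Mapping.lookup a i \<noteq> 0"
        using a by (metis poly_mapping_eqI lookup_zero)
      then show ?thesis by (intro prod_zero) (auto intro!: exI[of _ i])
    qed
    have "eval_via f (\<lambda>_. 0) d = (\<Sum>a\<in>insert 0 (Poly_Mapping.keys d). f (Poly_Mapping.lookup d a) *
        (\<Prod>i\<in>UNIV. 0 ^ Poly_Mapping.lookup a i))"
      by (rule eval_via_superset[OF f]) auto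
    also have "\<dots> = (\<Sum>a\<in>{0}. f (Poly_Mapping.lookup d a) * (\<Prod>i\<in>UNIV. 0 ^ Poly_Mapping.lookup a i))"
      by (rule sum.mono_neutral_right) (auto simp: z)
    finally show ?thesis by simp
  qed
  show ?case
    by (rule exI[of _ "\<lambda>_. 0"]) (auto simp: ev[OF \<iota>] ev[OF id] hom_same_sign[OF \<iota>])
next
  case (insert i S)
  let ?u = "\<lambda>j. if j \<in> S then u j else 0"
  obtain E where E: "finite E" "\<And>(\<phi> :: ('n, 'a) mpoly \<Rightarrow> 'b) (\<psi> :: ('n, 'a) mpoly \<Rightarrow> 'a) x.
      coeff_hom \<phi> \<Longrightarrow> coeff_hom \<psi> \<Longrightarrow> (\<And>e. e \<in> E \<Longrightarrow> same_sign (\<phi> e) (\<psi> e)) \<Longrightarrow>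
      \<exists>y. \<forall>d\<in>poly_in i ` D. same_sign (poly (map_poly \<phi> d) x) (poly (map_poly \<psi> d) y)"
    using eliminate_variable[where 'a = 'b and 'b = 'a, of "poly_in i ` D"] insert.prems by blast
  obtain v where v: "\<forall>e\<in>E. same_sign (eval_via \<iota> ?u e) (eval_via (\<lambda>c. c) v e)"
    using insert.IH[OF E(1)] by blast
  have id: "coeff_hom (\<lambda>c :: 'a. c)" by standard auto
  obtain y where y: "\<forall>d\<in>poly_in i ` D. same_sign (poly (map_poly (eval_via \<iota> ?u) d) (u i))
      (poly (map_poly (eval_via (\<lambda>c. c) v) d) y)"
    using E(2)[OF coeff_hom_eval_via[OF \<iota>] coeff_hom_eval_via[OF id], of ?u v] v by blast
  have "?u(i := u i) = (\<lambda>j. if j \<in> Set.insert i S then u j else 0)" by auto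
  then have "\<forall>d\<in>D. same_sign (eval_via \<iota> (\<lambda>j. if j \<in> Set.insert i S then u j else 0) d)
      (eval_via (\<lambda>c. c) (v(i := y)) d)"
    using y by (simp add: poly_poly_in[OF \<iota>] poly_poly_in[OF id])
  then show ?case by blast
qed

theorem solvable_transfer:
  fixes \<iota> :: "'a :: real_closed_field \<Rightarrow> 'b :: real_closed_field"
    and G :: "('n :: finite, 'a) mpoly set"
  assumes "coeff_hom \<iota>" "finite G" "\<And>g. g \<in> G \<Longrightarrow> eval_via \<iota> u g = 0"
  shows "solvable G"
proof -
  obtain v where v: "\<forall>g\<in>G. same_sign (eval_via \<iota> u g) (eval_via (\<lambda>c. c) v g)"
    using transfer_signs[OF assms(1) finite_class.finite_UNIV assms(2), of u] by auto
  have "mp_eval (\<chi> i. v i) g = 0" if "g \<in> G" for g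
    using v that assms(3)[OF that] same_sign_eq_0
    unfolding mp_eval_eq_eval_via by (metis (no_types, lifting) ext vec_lambda_beta)
  then show ?thesis unfolding solvable_def by blast
qed


section \<open>Real closure of a formally real field\<close>

inductive is_sos :: "'a :: comm_ring_1 \<Rightarrow> bool" where
  is_sos_0: "is_sos 0"
| is_sos_step: "is_sos s \<Longrightarrow> is_sos (s + h * h)"

lemma is_sos_square: "is_sos (h * h)"
  using is_sos_step[OF is_sos_0, of h] by simp

lemma is_sos_add: "is_sos t \<Longrightarrow> is_sos s \<Longrightarrow> is_sos (s + t)"
  by (induction t rule: is_sos.induct) (auto simp: add.assoc[symmetric] intro: is_sos_step)

lemma is_sos_mult_square: "is_sos s \<Longrightarrow> is_sos (s * (g * g))"
proof (induction s rule: is_sos.induct)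
  case (is_sos_step s h)
  have "(s + h * h) * (g * g) = s * (g * g) + (h * g) * (h * g)"
    by (simp only: distrib_left distrib_right mult_ac)
  then show ?case using is_sos.is_sos_step[OF is_sos_step.IH, of "h * g"] by (simp only:)
qed (simp add: is_sos_0)

lemma is_sos_mult: "is_sos t \<Longrightarrow> is_sos s \<Longrightarrow> is_sos (s * t)"
proof (induction t rule: is_sos.induct)
  case (is_sos_step t h)
  then show ?case unfolding distrib_left by (intro is_sos_add is_sos_mult_square)
qed (simp add: is_sos_0)

lemma is_sos_iff_sum: "is_sos s \<longleftrightarrow> (\<exists>n f. s = (\<Sum>k<n :: nat. f k * f k))"
proof
  assume "is_sos s"
  then show "\<exists>n f. s = (\<Sum>k<n :: nat. f k * f k)"
  proof induction
    case is_sos_0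
    show ?case by (rule exI[of _ 0]) simp
  next
    case (is_sos_step s h)
    then obtain n f where s: "s = (\<Sum>k<n :: nat. f k * f k)" by blast
    have "s + h * h = (\<Sum>k<Suc n. (f(n := h)) k * (f(n := h)) k)" by (simp add: s)
    then show ?case by blast
  qed
next
  have "is_sos (\<Sum>k<n. f k * f k)" for n and f :: "nat \<Rightarrow> 'a"
    by (induction n) (auto intro: is_sos.intros)
  then show "\<exists>n f. s = (\<Sum>k<n :: nat. f k * f k) \<Longrightarrow> is_sos s" by blast
qed

class formally_real_field = field +
  assumes sum_squares_neq_minus_one: "(\<Sum>k<n :: nat. f k * f k) \<noteq> - 1"

lemma not_is_sos_minus_one: "\<not> is_sos (- 1 :: 'a :: formally_real_field)"
  unfolding is_sos_iff_sum using sum_squares_neq_minus_one by (auto simp: eq_commute[of "- 1"])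

lemma formally_real_two_nonzero: "(2 :: 'a :: formally_real_field) \<noteq> 0"
proof
  assume "(2 :: 'a) = 0"
  then have "(1 :: 'a) + 1 = 0" by (simp only: one_add_one)
  then have "(- 1 :: 'a) = 1 * 1" using minus_unique by simp
  then show False using not_is_sos_minus_one is_sos_square by metis
qed

text \<open>
  Positive cones of preordered subrings of the algebraic closure: the ring in question consists of
  the differences of elements of \<open>T\<close>, and its squares are required to be in \<open>T\<close>. It contains the base field and
  is algebraic over it, hence is a field.
\<close>

definition real_cone :: "'a :: formally_real_field alg_closure set \<Rightarrow> bool" where
  "real_cone T \<longleftrightarrow> (\<forall>c. to_ac (c * c) \<in> T) \<and> (\<forall>s\<in>T. \<forall>t\<in>T. s + t \<in> T \<and> s * t \<in> T) \<and>
     (\<forall>s\<in>T. \<forall>t\<in>T. (s - t) * (s - t) \<in> T) \<and> - 1 \<notin> T"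

lemma real_cone_sos: "real_cone (to_ac ` {s :: 'a :: formally_real_field. is_sos s})"
proof -
  have "- 1 = to_ac (- 1 :: 'a)" by simp
  then have "- 1 \<noteq> to_ac s" if "is_sos s" for s :: 'a
    using that not_is_sos_minus_one to_ac_eq_iff by metis
  moreover have "(to_ac s - to_ac t) * (to_ac s - to_ac t) = to_ac ((s - t) * (s - t))" for s t :: 'a
    by simp
  ultimately show ?thesis
    unfolding real_cone_def
    by (auto simp flip: to_ac_add to_ac_mult simp del: to_ac_add to_ac_mult
        intro!: imageI intro: is_sos_add is_sos_mult is_sos_square)
qed

lemma maximal_real_cone_exists:
  "\<exists>T :: 'a :: formally_real_field alg_closure set. real_cone T \<and> (\<forall>T'. real_cone T' \<longrightarrow> T \<subseteq> T' \<longrightarrow> T' = T)"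
proof -
  have "\<exists>M\<in>{T :: 'a alg_closure set. real_cone T}. \<forall>X\<in>{T. real_cone T}. M \<subseteq> X \<longrightarrow> X = M"
  proof (rule subset_Zorn_nonempty)
    show "{T :: 'a alg_closure set. real_cone T} \<noteq> {}" using real_cone_sos by blast
    fix C :: "'a alg_closure set set"
    assume C: "C \<noteq> {}" "subset.chain {T. real_cone T} C"
    have cone: "real_cone T" if "T \<in> C" for T using C(2) that by (auto simp: subset.chain_def)
    have both: "\<exists>T\<in>C. s \<in> T \<and> t \<in> T" if "s \<in> \<Union> C" "t \<in> \<Union> C" for s t
      using that C(2) unfolding subset_chain_def by blast
    show "\<Union> C \<in> {T. real_cone T}"
      unfolding mem_Collect_eq real_cone_def
    proof (intro conjI allI ballI)
      show "to_ac (c * c) \<in> \<Union> C" for c using C(1) cone unfolding real_cone_def by blast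
      show "- 1 \<notin> \<Union> C" using cone unfolding real_cone_def by blast
      fix s t assume "s \<in> \<Union> C" "t \<in> \<Union> C"
      from both[OF this] obtain T where T: "T \<in> C" "s \<in> T" "t \<in> T" by blast
      then show "s + t \<in> \<Union> C" "s * t \<in> \<Union> C" "(s - t) * (s - t) \<in> \<Union> C"
        using cone[OF T(1)] unfolding real_cone_def by blast+
    qed
  qed
  then show ?thesis by blast
qed

text \<open>
  The elements of the real closure are the differences of elements of a maximal cone. As a constant,
  the cone can serve in a type definition.
\<close>

definition closure_cone :: "'a :: formally_real_field alg_closure set" where
  "closure_cone = (SOME T. real_cone T \<and> (\<forall>T'. real_cone T' \<longrightarrow> T \<subseteq> T' \<longrightarrow> T' = T))"

definition closure_carrier :: "'a :: formally_real_field alg_closure set" where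
  "closure_carrier = {s - t | s t. s \<in> closure_cone \<and> t \<in> closure_cone}"

lemma closure_cone: "real_cone closure_cone"
  and closure_cone_maximal: "real_cone T \<Longrightarrow> closure_cone \<subseteq> T \<Longrightarrow> T = closure_cone"
  using someI_ex[OF maximal_real_cone_exists] unfolding closure_cone_def by blast+

lemma cc_base: "to_ac (c * c) \<in> closure_cone"
  and cc_add: "s \<in> closure_cone \<Longrightarrow> t \<in> closure_cone \<Longrightarrow> s + t \<in> closure_cone"
  and cc_mult: "s \<in> closure_cone \<Longrightarrow> t \<in> closure_cone \<Longrightarrow> s * t \<in> closure_cone"
  and cc_minus_one: "- 1 \<notin> closure_cone"
  using closure_cone unfolding real_cone_def by blast+

lemma cc_square: "x \<in> closure_carrier \<Longrightarrow> x * x \<in> closure_cone"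
  using closure_cone unfolding real_cone_def closure_carrier_def by blast

lemma cc_0: "0 \<in> closure_cone" using cc_base[of 0] by simp

lemma cc_1: "1 \<in> closure_cone" using cc_base[of 1] by simp

lemma cone_subset_carrier: "closure_cone \<subseteq> closure_carrier"
  unfolding closure_carrier_def using cc_0 by force

lemma carrier_add: "x \<in> closure_carrier \<Longrightarrow> y \<in> closure_carrier \<Longrightarrow> x + y \<in> closure_carrier"
  unfolding closure_carrier_def
  by clarsimp (metis (no_types, lifting) cc_add add_diff_add)

lemma carrier_uminus: "x \<in> closure_carrier \<Longrightarrow> - x \<in> closure_carrier"
  unfolding closure_carrier_def by clarsimp (metis minus_diff_eq)

lemma carrier_diff: "x \<in> closure_carrier \<Longrightarrow> y \<in> closure_carrier \<Longrightarrow> x - y \<in> closure_carrier"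
  using carrier_add[of x "- y"] carrier_uminus[of y] by simp

lemma carrier_mult:
  assumes "x \<in> closure_carrier" "y \<in> closure_carrier" shows "x * y \<in> closure_carrier"
proof -
  obtain s t s' t' where st: "x = s - t" "y = s' - t'" "s \<in> closure_cone" "t \<in> closure_cone"
    "s' \<in> closure_cone" "t' \<in> closure_cone" using assms unfolding closure_carrier_def by blast
  have "x * y = (s * s' + t * t') - (s * t' + t * s')" unfolding st by (simp add: algebra_simps)
  then show ?thesis unfolding closure_carrier_def using st cc_add cc_mult by blast
qed

lemma carrier_0: "0 \<in> closure_carrier" and carrier_1: "1 \<in> closure_carrier"
  using cone_subset_carrier cc_0 cc_1 by blast+

lemma difference_of_squares:
  fixes c :: "'a :: field"
  assumes "(2 :: 'a) \<noteq> 0"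
  shows "c = ((c + 1) / 2) * ((c + 1) / 2) - ((c - 1) / 2) * ((c - 1) / 2)"
proof -
  have "(c + 1) / 2 + (c - 1) / 2 = (2 * c) / 2"
    unfolding add_divide_distrib[symmetric] by simp
  then have 1: "(c + 1) / 2 + (c - 1) / 2 = c" using assms by simp
  have "(c + 1) / 2 - (c - 1) / 2 = 2 / 2"
    unfolding diff_divide_distrib[symmetric] by simp
  then have 2: "(c + 1) / 2 - (c - 1) / 2 = 1" using assms by simp
  show ?thesis unfolding square_diff_square_factored 1 2 by simp
qed

lemma carrier_base: "to_ac c \<in> closure_carrier"
proof -
  have "c = ((c + 1) / 2) * ((c + 1) / 2) - ((c - 1) / 2) * ((c - 1) / 2)"
    by (rule difference_of_squares[OF formally_real_two_nonzero])
  then have "to_ac c = to_ac (((c + 1) / 2) * ((c + 1) / 2)) - to_ac (((c - 1) / 2) * ((c - 1) / 2))"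
    by (metis to_ac_diff)
  then show ?thesis unfolding closure_carrier_def using cc_base by blast
qed

text \<open>
  An equation \<open>a\<^sub>0 + a\<^sub>1 x + \<dots> + a\<^sub>n x\<^sup>n = 0\<close> over the base field with \<open>a\<^sub>0 \<noteq> 0\<close> expresses \<open>1 / x\<close> as a
  polynomial in \<open>x\<close>.
\<close>

lemma subring_inverse_closed:
  fixes S :: "'a :: field alg_closure set"
  assumes "\<And>c. to_ac c \<in> S" "\<And>x y. x \<in> S \<Longrightarrow> y \<in> S \<Longrightarrow> x + y \<in> S"
    and "\<And>x y. x \<in> S \<Longrightarrow> y \<in> S \<Longrightarrow> x * y \<in> S" "x \<in> S"
  shows "inverse x \<in> S"
proof (cases "x = 0")
  case True
  then show ?thesis using assms(1)[of 0] by simp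
next
  case False
  have eval: "poly (map_poly to_ac q) x \<in> S" for q
  proof (induction q)
    case 0
    then show ?case using assms(1)[of 0] by simp
  next
    case (pCons a q)
    then show ?case using assms by (simp add: map_poly_pCons)
  qed
  obtain p :: "'a poly" where "p \<noteq> 0" "poly (map_poly to_ac p) x = 0"
    using alg_closure_algebraic by blast
  then show ?thesis
  proof (induction p)
    case (pCons a p)
    have eq: "to_ac a + x * poly (map_poly to_ac p) x = 0" using pCons by (simp add: map_poly_pCons)
    show ?case
    proof (cases "a = 0")
      case True
      then show ?thesis using eq pCons False by auto
    next
      case a: False
      have "x * poly (map_poly to_ac p) x = - to_ac a"
        using eq by (simp add: eq_neg_iff_add_eq_0 add.commute)
      then have "x * (poly (map_poly to_ac p) x * to_ac (- inverse a)) = - to_ac a * to_ac (- inverse a)"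
        by (simp only: mult.assoc[symmetric])
      also have "\<dots> = 1" using a by simp
      finally have "x * (poly (map_poly to_ac p) x * to_ac (- inverse a)) = 1" .
      then have "inverse x = poly (map_poly to_ac p) x * to_ac (- inverse a)"
        by (rule inverse_unique)
      then show ?thesis using assms eval by metis
    qed
  qed simp
qed

lemma carrier_inverse: "x \<in> closure_carrier \<Longrightarrow> inverse x \<in> closure_carrier"
  by (rule subring_inverse_closed) (auto intro: carrier_base carrier_add carrier_mult)

lemma cc_inverse:
  assumes "t \<in> closure_cone" shows "inverse t \<in> closure_cone"
proof -
  have "inverse t = t * (inverse t * inverse t)" by (cases "t = 0") auto
  then show ?thesis
    using assms cone_subset_carrier carrier_inverse cc_square cc_mult by (metis subsetD)
qed

lemma cc_antisym:
  assumes "x \<in> closure_cone" "- x \<in> closure_cone" shows "x = 0"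
proof (rule ccontr)
  assume "x \<noteq> 0"
  then have "- 1 = - x * inverse x" by simp
  then show False using assms cc_mult cc_inverse cc_minus_one by metis
qed

lemma linear_form_add:
  fixes x :: "'a :: comm_ring_1"
  shows "(s - t * x) + (s' - t' * x) = (s + s') - (t + t') * x"
  by (simp add: algebra_simps)

lemma linear_form_mult:
  fixes x :: "'a :: comm_ring_1"
  shows "(s - t * x) * (s' - t' * x) = (s * s' + t * t' * (x * x)) - (s * t' + t * s') * x"
  by (simp add: algebra_simps)

text \<open>
  If neither \<open>x\<close> nor \<open>- x\<close> were in the maximal cone, adjoining \<open>- x\<close> would have to produce \<open>- 1 = s - t x\<close>;
  but then \<open>x = (1 + s) / t\<close> is in the cone.
\<close>

lemma cc_total:
  assumes x: "x \<in> closure_carrier" shows "x \<in> closure_cone \<or> - x \<in> closure_cone"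
proof (cases "x \<in> closure_cone")
  case nx: False
  define T where "T = {s - t * x | s t. s \<in> closure_cone \<and> t \<in> closure_cone}"
  have T: "s - t * x \<in> T" if "s \<in> closure_cone" "t \<in> closure_cone" for s t
    unfolding T_def using that by blast
  have sub: "closure_cone \<subseteq> T" using T[OF _ cc_0] by auto
  have carrier: "T \<subseteq> closure_carrier"
    unfolding T_def using x cone_subset_carrier carrier_diff carrier_mult by blast
  have "- 1 \<notin> T"
  proof
    assume "- 1 \<in> T"
    then obtain s t where st: "s \<in> closure_cone" "t \<in> closure_cone" "- 1 = s - t * x"
      unfolding T_def by blast
    then have eq: "t * x = 1 + s" by (simp add: algebra_simps)
    have "t \<noteq> 0" using st cc_minus_one by auto
    then have "x = (1 + s) * inverse t" using eq by (simp add: field_simps)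
    then show False using nx st cc_1 cc_add cc_mult cc_inverse by metis
  qed
  moreover have "u + v \<in> T \<and> u * v \<in> T" if uv: "u \<in> T" "v \<in> T" for u v
  proof -
    obtain s t s' t' where st: "u = s - t * x" "v = s' - t' * x" "s \<in> closure_cone" "t \<in> closure_cone"
      "s' \<in> closure_cone" "t' \<in> closure_cone" using uv unfolding T_def by blast
    have e: "u + v = (s + s') - (t + t') * x"
      "u * v = (s * s' + t * t' * (x * x)) - (s * t' + t * s') * x"
      unfolding st(1,2) by (rule linear_form_add linear_form_mult)+
    have "(s + s') - (t + t') * x \<in> T"
      using st by (intro T cc_add)
    moreover have "(s * s' + t * t' * (x * x)) - (s * t' + t * s') * x \<in> T"
      using st x by (intro T cc_add cc_mult cc_square)
    ultimately show ?thesis unfolding e by blast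
  qed
  moreover have "(u - v) * (u - v) \<in> T" if "u \<in> T" "v \<in> T" for u v
    using that sub carrier cc_square carrier_diff by (meson subsetD)
  ultimately have "real_cone T" unfolding real_cone_def using sub cc_base by blast
  then have "T = closure_cone" using closure_cone_maximal sub by blast
  then show ?thesis using T[OF cc_0 cc_1] by simp
qed simp

typedef (overloaded) 'a real_closure = "closure_carrier :: 'a :: formally_real_field alg_closure set"
  morphisms of_rc Abs_rc
  using carrier_0 by blast

setup_lifting type_definition_real_closure

instantiation real_closure :: (formally_real_field) linordered_field
begin

lift_definition zero_real_closure :: "'a real_closure" is 0 by (rule carrier_0)
lift_definition one_real_closure :: "'a real_closure" is 1 by (rule carrier_1)
lift_definition plus_real_closure :: "'a real_closure \<Rightarrow> 'a real_closure \<Rightarrow> 'a real_closure" is "(+)"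
  by (rule carrier_add)
lift_definition uminus_real_closure :: "'a real_closure \<Rightarrow> 'a real_closure" is uminus
  by (rule carrier_uminus)
lift_definition minus_real_closure :: "'a real_closure \<Rightarrow> 'a real_closure \<Rightarrow> 'a real_closure" is "(-)"
  by (rule carrier_diff)
lift_definition times_real_closure :: "'a real_closure \<Rightarrow> 'a real_closure \<Rightarrow> 'a real_closure" is "(*)"
  by (rule carrier_mult)
lift_definition inverse_real_closure :: "'a real_closure \<Rightarrow> 'a real_closure" is inverse
  by (rule carrier_inverse)
lift_definition divide_real_closure :: "'a real_closure \<Rightarrow> 'a real_closure \<Rightarrow> 'a real_closure" is "(/)"
  by (simp add: divide_inverse carrier_mult carrier_inverse)
lift_definition less_eq_real_closure :: "'a real_closure \<Rightarrow> 'a real_closure \<Rightarrow> bool"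
  is "\<lambda>x y. y - x \<in> closure_cone" .
definition less_real_closure :: "'a real_closure \<Rightarrow> 'a real_closure \<Rightarrow> bool" where
  "less_real_closure x y \<longleftrightarrow> x \<le> y \<and> \<not> y \<le> x"
definition abs_real_closure :: "'a real_closure \<Rightarrow> 'a real_closure" where
  "abs_real_closure x = (if x < 0 then - x else x)"
definition sgn_real_closure :: "'a real_closure \<Rightarrow> 'a real_closure" where
  "sgn_real_closure x = (if x = 0 then 0 else if 0 < x then 1 else - 1)"

instance
proof
  fix a b c :: "'a real_closure"
  show "a + b + c = a + (b + c)" by transfer simp
  show "a + b = b + a" by transfer simp
  show "0 + a = a" by transfer simp
  show "a + b - a = b" "a - b - c = a - (b + c)" by (transfer, simp)+
  show "0 * a = 0" "a * 0 = 0" by (transfer, simp)+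
  show "- a + a = 0" by transfer simp
  show "a - b = a + - b" by transfer simp
  show "a * b * c = a * (b * c)" by transfer simp
  show "a * b = b * a" by transfer simp
  show "1 * a = a" by transfer simp
  show "(a + b) * c = a * c + b * c" by transfer (simp add: distrib_right)
  show "(0 :: 'a real_closure) \<noteq> 1" by transfer simp
  show "a \<noteq> 0 \<Longrightarrow> inverse a * a = 1" by transfer simp
  show "a div b = a * inverse b" by transfer (simp add: divide_inverse)
  show "inverse (0 :: 'a real_closure) = 0" by transfer simp
  show "a < b \<longleftrightarrow> a \<le> b \<and> \<not> b \<le> a" by (rule less_real_closure_def)
  show "a \<le> a" by transfer (simp add: cc_0)
  show "a \<le> b \<Longrightarrow> b \<le> c \<Longrightarrow> a \<le> c"
  proof transfer
    fix a b c :: "'a alg_closure"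
    assume "b - a \<in> closure_cone" "c - b \<in> closure_cone"
    from cc_add[OF this] show "c - a \<in> closure_cone" by simp
  qed
  show antisym: "a \<le> b \<Longrightarrow> b \<le> a \<Longrightarrow> a = b" for a b :: "'a real_closure"
  proof transfer
    fix a b :: "'a alg_closure"
    assume "b - a \<in> closure_cone" "a - b \<in> closure_cone"
    then show "a = b" using cc_antisym[of "b - a"] by simp
  qed
  show "a \<le> b \<or> b \<le> a"
  proof transfer
    fix a b :: "'a alg_closure"
    assume "a \<in> closure_carrier" "b \<in> closure_carrier"
    then show "b - a \<in> closure_cone \<or> a - b \<in> closure_cone"
      using cc_total[of "b - a"] carrier_diff[of b a] by simp
  qed
  show "a \<le> b \<Longrightarrow> c + a \<le> c + b" by transfer simp
  have mono: "a \<le> b \<Longrightarrow> 0 \<le> c \<Longrightarrow> c * a \<le> c * b"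
  proof transfer
    fix a b c :: "'a alg_closure"
    assume "b - a \<in> closure_cone" "c - 0 \<in> closure_cone"
    then have "c * (b - a) \<in> closure_cone" using cc_mult by simp
    then show "c * b - c * a \<in> closure_cone" by (simp add: right_diff_distrib)
  qed
  have cancel: "c * a = c * b \<Longrightarrow> c \<noteq> 0 \<Longrightarrow> a = b" by transfer simp
  show "a < b \<Longrightarrow> 0 < c \<Longrightarrow> c * a < c * b"
    using mono cancel antisym unfolding less_real_closure_def by metis
  show "\<bar>a\<bar> = (if a < 0 then - a else a)" by (rule abs_real_closure_def)
  show "sgn a = (if a = 0 then 0 else if 0 < a then 1 else - 1)" by (rule sgn_real_closure_def)
qed

end

lemma coeff_hom_of_rc: "coeff_hom of_rc"
  by standard (simp_all add: zero_real_closure.rep_eq one_real_closure.rep_eq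
      plus_real_closure.rep_eq times_real_closure.rep_eq)

definition base_rc :: "'a :: formally_real_field \<Rightarrow> 'a real_closure" where
  "base_rc c = Abs_rc (to_ac c)"

lemma of_rc_base_rc: "of_rc (base_rc c) = to_ac c"
  unfolding base_rc_def by (rule Abs_rc_inverse[OF carrier_base])

lemma coeff_hom_base_rc: "coeff_hom base_rc"
proof -
  interpret coeff_hom of_rc by (rule coeff_hom_of_rc)
  show ?thesis
    by standard (simp_all add: of_rc_inject[symmetric] of_rc_base_rc)
qed

lemma of_rc_nonneg: "0 \<le> x \<longleftrightarrow> of_rc x \<in> closure_cone"
  by transfer simp

text \<open>
  The values of these polynomials at \<open>\<alpha>\<close> form the cone that is generated by the squares when \<open>\<alpha>\<close> is
  adjoined to the ordered field.
\<close>

inductive weighted_sos :: "'k :: linordered_field poly \<Rightarrow> bool" where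
  wsos_0: "weighted_sos 0"
| wsos_step: "weighted_sos s \<Longrightarrow> 0 \<le> t \<Longrightarrow> weighted_sos (s + smult t (h * h))"

lemma wsos_single: "0 \<le> t \<Longrightarrow> weighted_sos (smult t (h * h))"
  using wsos_step[OF wsos_0] by fastforce

lemma wsos_add: "weighted_sos t \<Longrightarrow> weighted_sos s \<Longrightarrow> weighted_sos (s + t)"
  by (induction t rule: weighted_sos.induct) (auto simp: add.assoc[symmetric] intro: wsos_step)

lemma wsos_mult_square: "weighted_sos s \<Longrightarrow> 0 \<le> t \<Longrightarrow> weighted_sos (s * smult t (g * g))"
proof (induction s rule: weighted_sos.induct)
  case (wsos_step s t' h)
  have "(s + smult t' (h * h)) * smult t (g * g) = s * smult t (g * g) + smult (t' * t) ((h * g) * (h * g))"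
    by (simp add: distrib_right distrib_left smult_add_right mult_ac)
  then show ?case
    using weighted_sos.wsos_step[OF wsos_step.IH, of "t' * t" "h * g"] wsos_step by simp
qed (simp add: wsos_0)

lemma wsos_mult: "weighted_sos t \<Longrightarrow> weighted_sos s \<Longrightarrow> weighted_sos (s * t)"
proof (induction t rule: weighted_sos.induct)
  case (wsos_step t c h)
  then show ?case unfolding distrib_left by (intro wsos_add wsos_mult_square)
qed (simp add: wsos_0)

text \<open>
  Replacing each square \<open>h\<^sup>2\<close> by the square of \<open>h mod q\<close> changes nothing at a root of \<open>q\<close>, keeps the
  polynomial nonnegative and bounds its degree by less than twice the degree of \<open>q\<close>.
\<close>

lemma wsos_reduce:
  fixes q :: "'k :: linordered_field poly"
  assumes "weighted_sos s" "degree q > 0"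
  obtains s' v where "s = s' + q * v" "degree s' \<le> 2 * (degree q - 1)" "\<And>x. poly s' x \<ge> 0"
proof -
  have "\<exists>s' v. s = s' + q * v \<and> degree s' \<le> 2 * (degree q - 1) \<and> (\<forall>x. poly s' x \<ge> 0)"
    using assms(1)
  proof (induction rule: weighted_sos.induct)
    case wsos_0
    show ?case by (intro exI[of _ 0]) simp
  next
    case (wsos_step s t h)
    then obtain s' v where IH: "s = s' + q * v" "degree s' \<le> 2 * (degree q - 1)" "\<forall>x. poly s' x \<ge> 0"
      by blast
    define r e where "r = h mod q" and "e = h div q"
    have h: "h = q * e + r" by (simp add: r_def e_def)
    have "q \<noteq> 0" using assms(2) by auto
    have "degree r < degree q"
      using degree_mod_less[OF \<open>q \<noteq> 0\<close>, of h] assms(2) by (auto simp: r_def)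
    then have "degree (r * r) \<le> 2 * (degree q - 1)" by (intro order_trans[OF degree_mult_le]) simp
    then have "degree (s' + smult t (r * r)) \<le> 2 * (degree q - 1)"
      using IH(2) degree_smult_le[of t "r * r"] by (intro degree_add_le) auto
    moreover have "s + smult t (h * h) =
        (s' + smult t (r * r)) + q * (v + smult t (q * e * e + 2 * e * r))"
      unfolding IH(1) h by (simp add: algebra_simps smult_add_right)
    moreover have "poly (s' + smult t (r * r)) x \<ge> 0" for x
      using IH(3) wsos_step.hyps by (simp add: add_nonneg_nonneg)
    ultimately show ?case by blast
  qed
  then show ?thesis using that by blast
qed

definition eval_ac :: "'a :: formally_real_field alg_closure \<Rightarrow> 'a real_closure poly \<Rightarrow> 'a alg_closure" where
  "eval_ac \<alpha> h = poly (map_poly of_rc h) \<alpha>"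

lemma coeff_hom_eval_ac: "coeff_hom (eval_ac \<alpha>)"
proof -
  interpret coeff_hom of_rc by (rule coeff_hom_of_rc)
  show ?thesis unfolding eval_ac_def
    by standard (simp_all add: map_poly_hom_add map_poly_hom_mult)
qed

lemma eval_ac_const: "eval_ac \<alpha> [:c:] = of_rc c"
proof -
  interpret coeff_hom of_rc by (rule coeff_hom_of_rc)
  show ?thesis by (simp add: eval_ac_def map_poly_pCons)
qed

lemma eval_ac_X: "eval_ac \<alpha> [:0, 1:] = \<alpha>"
proof -
  interpret coeff_hom of_rc by (rule coeff_hom_of_rc)
  show ?thesis by (simp add: eval_ac_def map_poly_pCons)
qed

lemma of_rc_poly: "eval_ac (of_rc x) h = of_rc (poly h x)"
proof -
  interpret coeff_hom of_rc by (rule coeff_hom_of_rc)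
  show ?thesis unfolding eval_ac_def by (induction h) (simp_all add: map_poly_pCons)
qed

text \<open>
  Unless \<open>- 1\<close> becomes a weighted sum of squares, adjoining \<open>\<alpha>\<close> gives a larger cone; by maximality it is
  the old one. The identity \<open>4 \<alpha> = (\<alpha> + 1)\<^sup>2 - (\<alpha> - 1)\<^sup>2\<close> then places \<open>\<alpha>\<close> in the field.
\<close>

lemma adjoin_in_closure:
  fixes \<alpha> :: "'a :: formally_real_field alg_closure"
  assumes "\<And>s. weighted_sos s \<Longrightarrow> eval_ac \<alpha> s \<noteq> - 1"
  obtains c where "of_rc c = \<alpha>"
proof -
  interpret coeff_hom "eval_ac \<alpha>" by (rule coeff_hom_eval_ac)
  define T where "T = eval_ac \<alpha> ` {s. weighted_sos s}"
  have T: "eval_ac \<alpha> s \<in> T" if "weighted_sos s" for s using that by (simp add: T_def)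
  have sub: "closure_cone \<subseteq> T"
  proof
    fix t assume t: "t \<in> (closure_cone :: 'a alg_closure set)"
    then have t': "of_rc (Abs_rc t) = t" using Abs_rc_inverse cone_subset_carrier by blast
    then have "0 \<le> Abs_rc t" using t by (simp add: of_rc_nonneg)
    then have "weighted_sos [:Abs_rc t:]" using wsos_single[of "Abs_rc t" 1] by simp
    from T[OF this] show "t \<in> T" by (simp add: eval_ac_const t')
  qed
  have "real_cone T" unfolding real_cone_def
  proof (intro conjI allI ballI)
    show "to_ac (c * c) \<in> T" for c using sub cc_base by blast
    show "- 1 \<notin> T" using assms by (force simp: T_def)
    fix s t assume "s \<in> T" "t \<in> T"
    then obtain f g where fg: "s = eval_ac \<alpha> f" "t = eval_ac \<alpha> g" "weighted_sos f" "weighted_sos g"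
      by (auto simp: T_def)
    show "s + t \<in> T" "s * t \<in> T" "(s - t) * (s - t) \<in> T"
      using T[OF wsos_add[OF fg(4,3)]] T[OF wsos_mult[OF fg(4,3)]]
        T[OF wsos_single[of 1 "f - g"]] by (simp_all add: fg(1,2))
  qed
  then have T_eq: "T = closure_cone" using closure_cone_maximal sub by blast
  let ?X = "[:0, 1:] :: 'a real_closure poly"
  have half: "smult (1 / 4) ((?X + 1) * (?X + 1)) - smult (1 / 4) ((?X - 1) * (?X - 1)) = ?X"
    by (simp add: one_pCons)
  have "eval_ac \<alpha> (smult (1 / 4) (h * h)) \<in> closure_cone" for h
    using T[OF wsos_single[of "1 / 4" h]] T_eq by simp
  then have "eval_ac \<alpha> (smult (1 / 4) ((?X + 1) * (?X + 1))) - eval_ac \<alpha> (smult (1 / 4) ((?X - 1) * (?X - 1)))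
      \<in> closure_carrier" unfolding closure_carrier_def by blast
  then have "\<alpha> \<in> closure_carrier" unfolding hom_diff[symmetric] half eval_ac_X .
  then show ?thesis using that Abs_rc_inverse by blast
qed

text \<open>
  By induction on the degree, a polynomial \<open>q\<close> that changes sign between \<open>a\<close> and \<open>b\<close> may be assumed to be the
  minimal polynomial of a root \<open>\<alpha>\<close> in the algebraic closure. If \<open>\<alpha>\<close> cannot be adjoined, then
  \<open>1 + s = q r\<close> for some \<open>s\<close> that is nowhere negative and of degree less than twice that of \<open>q\<close>. So \<open>r\<close> has smaller
  degree than \<open>q\<close> and changes sign together with \<open>q\<close>, and at a root of \<open>r\<close> the left-hand side vanishes
  although it is at least 1.
\<close>

theorem real_closure_IVT:
  fixes q :: "'a :: formally_real_field real_closure poly"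
  assumes "a < b" "poly q a * poly q b < 0"
  shows "\<exists>c>a. c < b \<and> poly q c = 0"
  using assms(2)
proof (induction "degree q" arbitrary: q rule: less_induct)
  case less
  note sc = less.prems
  have q0: "q \<noteq> 0" "poly q a \<noteq> 0" "poly q b \<noteq> 0" using sc by auto
  have deg: "degree q > 0"
  proof (rule ccontr)
    assume "\<not> ?thesis"
    then obtain c where "q = [:c:]" using degree_eq_zeroE by blast
    then show False using sc by (simp add: mult_less_0_iff)
  qed
  have factor: "\<exists>c>a. c < b \<and> poly q c = 0" if fact: "q = f * g" "degree f < degree q" "degree g < degree q" for f g
  proof -
    have "poly q a * poly q b = (poly f a * poly f b) * (poly g a * poly g b)"
      unfolding fact(1) by (simp add: mult_ac)
    then consider "poly f a * poly f b < 0" | "poly g a * poly g b < 0"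
      using sc by (auto simp: mult_less_0_iff)
    then show ?thesis
    proof cases
      case 1
      then show ?thesis using less.hyps[OF fact(2)] fact(1) by auto
    next
      case 2
      then show ?thesis using less.hyps[OF fact(3)] fact(1) by auto
    qed
  qed
  show ?case
  proof (cases "\<exists>c. poly q c = 0")
    case True
    then obtain c where c: "poly q c = 0" by blast
    show ?thesis
    proof (cases "a < c \<and> c < b")
      case False
      obtain r where r: "q = [:- c, 1:] * r" using c by (metis poly_eq_0_iff_dvd dvdE)
      then have "r \<noteq> 0" using q0 by auto
      then have dr: "degree r < degree q" unfolding r by (subst degree_mult_eq) auto
      have "(a - c) * (b - c) > 0"
        using False c q0 \<open>a < b\<close> by (cases "c < a"; cases "c = a"; cases "c = b")
          (auto simp: zero_less_mult_iff)
      moreover have "poly q a * poly q b = ((a - c) * (b - c)) * (poly r a * poly r b)"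
        unfolding r by (simp add: algebra_simps)
      ultimately have "poly r a * poly r b < 0"
        using sc by (metis mult_less_cancel_left_pos mult_zero_right)
      then show ?thesis using less.hyps[OF dr] r by auto
    qed (use c in blast)
  next
    case no_root: False
    interpret coeff_hom "of_rc :: 'a real_closure \<Rightarrow> _" by (rule coeff_hom_of_rc)
    have inj: "of_rc x = 0 \<longleftrightarrow> x = 0" for x :: "'a real_closure"
      by transfer simp
    have "degree (map_poly of_rc q) = degree q" by (rule degree_map_poly) (simp add: inj)
    then obtain \<alpha> where "poly (map_poly of_rc q) \<alpha> = 0"
      using alg_closed_imp_poly_has_root deg by metis
    then have \<alpha>: "eval_ac \<alpha> q = 0" by (simp add: eval_ac_def)
    interpret E: coeff_hom "eval_ac \<alpha>" by (rule coeff_hom_eval_ac)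
    define P where "P h \<longleftrightarrow> h \<noteq> 0 \<and> eval_ac \<alpha> h = 0" for h
    obtain h where h: "P h" "\<And>g. P g \<Longrightarrow> degree h \<le> degree g"
      using ex_has_least_nat[of P q degree] \<alpha> q0 by (auto simp: P_def)
    have dvd: "h dvd f" if f: "eval_ac \<alpha> f = 0" for f
    proof -
      have "f mod h = f - h * (f div h)" by (simp add: minus_mult_div_eq_mod)
      then have "eval_ac \<alpha> (f mod h) = 0" using f h(1) by (simp add: P_def)
      then have "f mod h = 0 \<or> degree h \<le> degree (f mod h)" using h(2) by (auto simp: P_def)
      then have "f mod h = 0" using degree_mod_less[of h f] h(1) by (auto simp: P_def)
      then show ?thesis by (simp add: dvd_eq_mod_eq_0)
    qed
    have deg_h: "degree h > 0"
    proof (rule ccontr)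
      assume "\<not> ?thesis"
      then obtain c where "h = [:c:]" using degree_eq_zeroE by blast
      then show False using h(1) by (simp add: P_def eval_ac_const inj)
    qed
    obtain g where g: "q = h * g" using dvd[OF \<alpha>] by (elim dvdE)
    then have "h \<noteq> 0" "g \<noteq> 0" using q0 by auto
    then have deg_sum: "degree q = degree h + degree g" unfolding g by (rule degree_mult_eq)
    have "\<not> (degree h < degree q \<and> degree g < degree q)"
      using factor[OF g] no_root by blast
    then have "degree g = 0" using deg_h deg_sum by auto
    then obtain d where d: "g = [:d:]" using degree_eq_zeroE by blast
    then have "d \<noteq> 0" using \<open>g \<noteq> 0\<close> by simp
    have q_dvd: "q dvd f" if "eval_ac \<alpha> f = 0" for f
      using dvd[OF that] \<open>d \<noteq> 0\<close> unfolding g d by (simp add: smult_dvd)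
    have "eval_ac \<alpha> s \<noteq> - 1" if s: "weighted_sos s" for s
    proof
      assume s1: "eval_ac \<alpha> s = - 1"
      obtain s' v where s': "s = s' + q * v" "degree s' \<le> 2 * (degree q - 1)" "\<And>x. poly s' x \<ge> 0"
        using wsos_reduce[OF s deg] by metis
      have "eval_ac \<alpha> (1 + s') = 0" using s1 \<alpha> unfolding s'(1) by simp
      then obtain r where r: "1 + s' = q * r" using q_dvd by (meson dvdE)
      have pos: "poly (1 + s') x > 0" for x using s'(3)[of x] by (simp add: add_pos_nonneg)
      have "r \<noteq> 0" using pos[of a] r by auto
      then have "degree (1 + s') = degree q + degree r" unfolding r using q0 by (intro degree_mult_eq) auto
      moreover have "degree (1 + s') \<le> 2 * (degree q - 1)" using s'(2) by (intro degree_add_le) auto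
      ultimately have dr: "degree r < degree q" using deg by simp
      have "poly (1 + s') a * poly (1 + s') b > 0" using pos by simp
      moreover have "poly (1 + s') a * poly (1 + s') b = (poly q a * poly q b) * (poly r a * poly r b)"
        unfolding r by (simp add: mult_ac)
      ultimately have "poly r a * poly r b < 0"
        using sc by (metis mult_nonpos_nonneg not_less order_less_imp_le)
      then obtain c where "poly r c = 0" using less.hyps[OF dr] by blast
      then show False using pos[of c] r by simp
    qed
    then obtain c where "of_rc c = \<alpha>" using adjoin_in_closure by blast
    then have "poly q c = 0" using \<alpha> of_rc_poly[of c q] inj by simp
    then show ?thesis using no_root by blast
  qed
qed

instance real_closure :: (formally_real_field) real_closed_field
proof
  fix a b :: "'a real_closure" and f :: "nat \<Rightarrow> 'a real_closure" and n :: nat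
  assume *: "a < b" "(\<Sum>k\<le>n. f k * a ^ k) < 0" "0 < (\<Sum>k\<le>n. f k * b ^ k)"
  then show "\<exists>c>a. c < b \<and> (\<Sum>k\<le>n. f k * c ^ k) = 0"
    using real_closure_IVT[of a b "\<Sum>k\<le>n. monom (f k) k"]
    by (simp add: poly_sum poly_monom mult_neg_pos)
qed

section \<open>Real prime ideals and their function fields\<close>

text \<open>
  This is used for \<open>S = {1}\<close> and for \<open>S\<close> consisting of the elements \<open>1 + s\<close> where \<open>s\<close> is a sum of squares.
\<close>

lemma maximal_disjoint_ideal:
  fixes I :: "'r :: comm_ring_1 set"
  assumes "ideal.subspace I" "I \<inter> S = {}"
  obtains J where "ideal.subspace J" "I \<subseteq> J" "J \<inter> S = {}"
    and "\<And>a. a \<notin> J \<Longrightarrow> \<exists>j\<in>J. \<exists>c. j + c * a \<in> S"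
proof -
  define A where "A = {J. ideal.subspace J \<and> I \<subseteq> J \<and> J \<inter> S = {}}"
  have "\<exists>M\<in>A. \<forall>X\<in>A. M \<subseteq> X \<longrightarrow> X = M"
  proof (rule subset_Zorn_nonempty)
    show "A \<noteq> {}" using assms unfolding A_def by blast
    fix C assume C: "C \<noteq> {}" "subset.chain A C"
    have CA: "J \<in> A" if "J \<in> C" for J using C(2) that unfolding subset_chain_def by blast
    have both: "\<exists>J\<in>C. s \<in> J \<and> t \<in> J" if "s \<in> \<Union> C" "t \<in> \<Union> C" for s t
      using that C(2) unfolding subset_chain_def by blast
    have "ideal.subspace (\<Union> C)"
      unfolding ideal.subspace_def
    proof (intro conjI ballI allI)
      show "0 \<in> \<Union> C" using C(1) CA unfolding A_def ideal.subspace_def by blast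
      show "c * x \<in> \<Union> C" if "x \<in> \<Union> C" for c x
        using that CA unfolding A_def ideal.subspace_def by blast
      fix x y assume "x \<in> \<Union> C" "y \<in> \<Union> C"
      from both[OF this] show "x + y \<in> \<Union> C"
        using CA unfolding A_def ideal.subspace_def by blast
    qed
    moreover have "I \<subseteq> \<Union> C" using C(1) CA unfolding A_def by blast
    moreover have "\<Union> C \<inter> S = {}" using CA unfolding A_def by blast
    ultimately show "\<Union> C \<in> A" unfolding A_def by blast
  qed
  then obtain J where JA: "J \<in> A" and max: "\<And>X. X \<in> A \<Longrightarrow> J \<subseteq> X \<Longrightarrow> X = J" by blast
  have J: "ideal.subspace J" "I \<subseteq> J" "J \<inter> S = {}" using JA unfolding A_def by blast+
  have "\<exists>j\<in>J. \<exists>c. j + c * a \<in> S" if a: "a \<notin> J" for a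
  proof -
    let ?J = "ideal.span (insert a J)"
    have sub: "J \<subseteq> ?J" "a \<in> ?J" using ideal.span_superset[of "insert a J"] by blast+
    then have "?J \<notin> A" using max a by blast
    then obtain x where x: "x \<in> ?J" "x \<in> S"
      using J(2) sub(1) unfolding A_def by (auto simp: ideal.subspace_span)
    then obtain c where "x - c * a \<in> ideal.span J" unfolding ideal.span_insert by blast
    then have "x - c * a \<in> J" using J(1) by (simp add: ideal.span_eq_iff[THEN iffD2])
    moreover have "(x - c * a) + c * a \<in> S" using x by simp
    ultimately show ?thesis by blast
  qed
  then show ?thesis using that J by blast
qed

text \<open>
  The prime ideals whose residue field is formally real.
\<close>

definition real_prime :: "'r :: comm_ring_1 set \<Rightarrow> bool" where
  "real_prime J \<longleftrightarrow> ideal.subspace J \<and> 1 \<notin> J \<and> (\<forall>a b. a * b \<in> J \<longrightarrow> a \<in> J \<or> b \<in> J) \<and>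
     (\<forall>s b. is_sos s \<longrightarrow> s + b * b \<in> J \<longrightarrow> b \<in> J)"

text \<open>
  For elements \<open>a\<close> and \<open>b\<close> outside a maximal \<open>J\<close> there are multiples of \<open>a\<close> and of \<open>b\<close> that are congruent to
  some \<open>1 + s\<close> and \<open>1 + t\<close>. As \<open>(1 + s) (1 + t)\<close> is again of this form, \<open>a b\<close> is not in \<open>J\<close>. Similarly, if
  \<open>s + b\<^sup>2\<close> is in \<open>J\<close> and \<open>d b\<close> is congruent to \<open>1 + t\<close>, then \<open>(1 + t)\<^sup>2 + d\<^sup>2 s\<close> is in \<open>J\<close>, a contradiction.
\<close>

lemma real_prime_exists:
  fixes I :: "'r :: comm_ring_1 set"
  assumes "ideal.subspace I" "\<And>s. is_sos s \<Longrightarrow> 1 + s \<notin> I"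
  obtains J where "I \<subseteq> J" "real_prime J"
proof -
  define S where "S = {1 + s :: 'r | s. is_sos s}"
  have "I \<inter> S = {}" using assms(2) unfolding S_def by blast
  then obtain J where J: "ideal.subspace J" "I \<subseteq> J" "J \<inter> S = {}"
    and max: "\<And>a. a \<notin> J \<Longrightarrow> \<exists>j\<in>J. \<exists>c. j + c * a \<in> S"
    using maximal_disjoint_ideal[OF assms(1)] by metis
  have sos: "1 + s \<notin> J" if "is_sos s" for s using J(3) that unfolding S_def by blast
  have outside: "\<exists>j c s. j \<in> J \<and> is_sos s \<and> 1 + s = j + c * a" if a: "a \<notin> J" for a
  proof -
    obtain j c where jc: "j \<in> J" "j + c * a \<in> S" using max[OF a] by blast
    then obtain s where "is_sos s" "j + c * a = 1 + s" unfolding S_def by blast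
    then show ?thesis using jc(1) by metis
  qed
  note add = ideal.subspace_add[OF J(1)] and scale = ideal.subspace_scale[OF J(1)]
  have "a \<in> J \<or> b \<in> J" if ab: "a * b \<in> J" for a b
  proof (rule ccontr)
    assume "\<not> ?thesis"
    then obtain j c s j' d t where *: "j \<in> J" "is_sos s" "1 + s = j + c * a"
      "j' \<in> J" "is_sos t" "1 + t = j' + d * b" using outside by metis
    have "1 + (s + t + s * t) = (1 + s) * (1 + t)" by (simp add: algebra_simps)
    also have "\<dots> = (j' + d * b) * j + (c * a) * j' + (c * d) * (a * b)"
      unfolding *(3,6) by (simp add: algebra_simps)
    also have "\<dots> \<in> J" by (intro add scale * ab)
    finally show False using sos[of "s + t + s * t"] * by (simp add: is_sos_add is_sos_mult)
  qed
  moreover have "b \<in> J" if sb: "is_sos s" "s + b * b \<in> J" for s b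
  proof (rule ccontr)
    assume "b \<notin> J"
    then obtain j d t where *: "j \<in> J" "is_sos t" "1 + t = j + d * b" using outside by metis
    have "1 + (t + t + t * t + s * (d * d)) = (1 + t) * (1 + t) + (d * d) * s" by (simp add: algebra_simps)
    also have "\<dots> = (j + d * b + d * b) * j + (d * d) * (s + b * b)"
      unfolding *(3) by (simp add: algebra_simps)
    also have "\<dots> \<in> J" by (intro add scale * sb)
    finally have "1 + (t + t + t * t + s * (d * d)) \<in> J" .
    moreover have "is_sos (t + t + t * t + s * (d * d))"
      using * sb by (intro is_sos_add is_sos_mult is_sos_square)
    ultimately show False using sos by blast
  qed
  moreover have "1 \<notin> J" using sos[OF is_sos_0] by simp
  ultimately have "real_prime J" unfolding real_prime_def using J(1) by blast
  then show ?thesis using that J(2) by blast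
qed

class formally_real_idom = idom +
  assumes sum_squares_eq_0: "(\<Sum>k<n :: nat. f k * f k) + b * b = 0 \<Longrightarrow> b = 0"

lemma is_sos_add_square_eq_0: "is_sos s \<Longrightarrow> s + b * b = 0 \<Longrightarrow> b = 0" for b :: "'r :: formally_real_idom"
  using sum_squares_eq_0 unfolding is_sos_iff_sum by blast

text \<open>
  A common denominator turns a sum of squares of fractions into one in the domain.
\<close>

lemma is_sos_fract:
  fixes s :: "'r :: formally_real_idom fract"
  shows "is_sos s \<Longrightarrow> \<exists>d t. d \<noteq> 0 \<and> is_sos t \<and> s * (to_fract d * to_fract d) = to_fract t"
proof (induction rule: is_sos.induct)
  case is_sos_0
  show ?case by (intro exI[of _ 1] exI[of _ 0]) (simp add: is_sos.is_sos_0)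
next
  case (is_sos_step s h)
  then obtain d t where dt: "d \<noteq> 0" "is_sos t" "s * (to_fract d * to_fract d) = to_fract t" by blast
  obtain a b where ab: "h = Fract a b" "b \<noteq> 0" by (cases h) auto
  have hb: "h * to_fract b = to_fract a"
    using ab by (simp add: to_fract_def eq_fract)
  have "(s + h * h) * (to_fract (d * b) * to_fract (d * b)) =
      (s * (to_fract d * to_fract d)) * (to_fract b * to_fract b) +
      (h * to_fract b) * (h * to_fract b) * (to_fract d * to_fract d)"
    by (simp add: algebra_simps)
  also have "\<dots> = to_fract (t * (b * b) + (a * d) * (a * d))"
    unfolding dt(3) hb by (simp add: algebra_simps)
  finally show ?case
    using dt ab is_sos.is_sos_step[OF is_sos_mult_square[OF dt(2), of b], of "a * d"]
    by (intro exI[of _ "d * b"] exI[of _ "t * (b * b) + (a * d) * (a * d)"]) simp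
qed

instance fract :: (formally_real_idom) formally_real_field
proof
  fix n :: nat and f :: "nat \<Rightarrow> 'a fract"
  show "(\<Sum>k<n. f k * f k) \<noteq> - 1"
  proof
    assume "(\<Sum>k<n. f k * f k) = - 1"
    then have "is_sos (- 1 :: 'a fract)" unfolding is_sos_iff_sum by metis
    then obtain d t :: 'a where dt: "d \<noteq> 0" "is_sos t" "- 1 * (to_fract d * to_fract d) = to_fract t"
      using is_sos_fract by blast
    have "to_fract (t + d * d) = - 1 * (to_fract d * to_fract d) + to_fract d * to_fract d"
      by (simp add: dt(3)[symmetric])
    also have "\<dots> = 0" by simp
    finally have "t + d * d = 0" by (simp only: to_fract_eq_0_iff)
    then show False using is_sos_add_square_eq_0 dt by blast
  qed
qed

lemma coeff_hom_id: "coeff_hom (\<lambda>c. c)"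
  by standard auto

lemma coeff_hom_mp_eval: "coeff_hom (mp_eval x)"
  unfolding mp_eval_eq_eval_via[abs_def] by (rule coeff_hom_eval_via[OF coeff_hom_id])

lemma mp_eval_sos_nonneg: "is_sos s \<Longrightarrow> mp_eval x s \<ge> (0 :: real)"
proof (induction rule: is_sos.induct)
  interpret coeff_hom "mp_eval x :: _ \<Rightarrow> real" by (rule coeff_hom_mp_eval)
  show "mp_eval x 0 \<ge> 0" by simp
  show "mp_eval x s \<ge> 0 \<Longrightarrow> mp_eval x (s + h * h) \<ge> 0" for s h by simp
qed

lemma span_subset_vanishing:
  assumes "\<And>g. g \<in> G \<Longrightarrow> mp_eval x g = 0" "f \<in> ideal.span G"
  shows "mp_eval x f = 0"
proof -
  interpret coeff_hom "mp_eval x" by (rule coeff_hom_mp_eval)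
  have "ideal.span G \<subseteq> {f. mp_eval x f = 0}"
    using assms(1) by (intro ideal.span_minimal) (auto simp: ideal.subspace_def)
  then show ?thesis using assms(2) by blast
qed

lemma real_prime_vanishing_at_0: "real_prime {p :: ('n :: finite, real) mpoly. mp_eval 0 p = 0}"
proof -
  interpret coeff_hom "mp_eval 0 :: ('n, real) mpoly \<Rightarrow> real" by (rule coeff_hom_mp_eval)
  have "mp_eval 0 b = 0" if "is_sos s" "mp_eval 0 s + mp_eval 0 b * mp_eval 0 b = 0"
    for s b :: "('n, real) mpoly"
    using mp_eval_sos_nonneg[OF that(1), of 0] that(2) by (metis add_nonneg_eq_0_iff mult_eq_0_iff zero_le_square)
  then show ?thesis by (auto simp: real_prime_def ideal.subspace_def)
qed

text \<open>
  A type cannot depend on the system under consideration, so that a single real prime ideal must serve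
  for all systems. It is chosen so as to be above an unsolvable system if any real prime ideal is; a
  contradiction for this one ideal therefore refutes all counterexamples. The vanishing ideal of the
  origin shows that some choice exists.
\<close>

definition chosen_prime :: "('n :: finite, real) mpoly set" where
  "chosen_prime = (SOME J. real_prime J \<and>
     ((\<exists>(G :: ('n, real) mpoly set) J'. finite G \<and> \<not> solvable G \<and> real_prime J' \<and> G \<subseteq> J') \<longrightarrow>
      (\<exists>G :: ('n, real) mpoly set. finite G \<and> \<not> solvable G \<and> G \<subseteq> J)))"

lemma chosen_prime:
  shows real_prime_chosen: "real_prime (chosen_prime :: ('n :: finite, real) mpoly set)"
    and chosen_prime_bad: "finite (G :: ('n, real) mpoly set) \<Longrightarrow> \<not> solvable G \<Longrightarrow> real_prime J \<Longrightarrow> G \<subseteq> J \<Longrightarrow>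
      \<exists>G'. finite G' \<and> \<not> solvable G' \<and> G' \<subseteq> (chosen_prime :: ('n, real) mpoly set)"
proof -
  let ?P = "\<lambda>J :: ('n, real) mpoly set. real_prime J \<and>
     ((\<exists>(G :: ('n, real) mpoly set) J'. finite G \<and> \<not> solvable G \<and> real_prime J' \<and> G \<subseteq> J') \<longrightarrow>
      (\<exists>G. finite G \<and> \<not> solvable G \<and> G \<subseteq> J))"
  have "\<exists>J. ?P J" using real_prime_vanishing_at_0 by blast
  then have P: "?P chosen_prime" unfolding chosen_prime_def by (rule someI_ex)
  show "real_prime (chosen_prime :: ('n, real) mpoly set)" using P by blast
  show "finite (G :: ('n, real) mpoly set) \<Longrightarrow> \<not> solvable G \<Longrightarrow> real_prime J \<Longrightarrow> G \<subseteq> J \<Longrightarrow>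
      \<exists>G'. finite G' \<and> \<not> solvable G' \<and> G' \<subseteq> (chosen_prime :: ('n, real) mpoly set)"
    using P by blast
qed

lemma chosen_subspace: "ideal.subspace chosen_prime"
  and one_notin_chosen: "1 \<notin> chosen_prime"
  and chosen_prime_mult: "a * b \<in> chosen_prime \<Longrightarrow> a \<in> chosen_prime \<or> b \<in> chosen_prime"
  and chosen_prime_real: "is_sos s \<Longrightarrow> s + b * b \<in> chosen_prime \<Longrightarrow> b \<in> chosen_prime"
  using real_prime_chosen unfolding real_prime_def by blast+

lemmas chosen_add = ideal.subspace_add[OF chosen_subspace]
  and chosen_diff = ideal.subspace_diff[OF chosen_subspace]
  and chosen_neg = ideal.subspace_neg[OF chosen_subspace]
  and chosen_scale = ideal.subspace_scale[OF chosen_subspace]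
  and chosen_0 = ideal.subspace_0[OF chosen_subspace]

quotient_type (overloaded) 'n coord_ring = "('n :: finite, real) mpoly" / "\<lambda>p q. p - q \<in> chosen_prime"
proof (rule equivpI)
  show "reflp (\<lambda>p q :: ('n, real) mpoly. p - q \<in> chosen_prime)" by (simp add: reflp_def chosen_0)
  show "symp (\<lambda>p q :: ('n, real) mpoly. p - q \<in> chosen_prime)"
  proof (rule sympI)
    fix p q :: "('n, real) mpoly"
    assume "p - q \<in> chosen_prime"
    from chosen_neg[OF this] show "q - p \<in> chosen_prime" by simp
  qed
  show "transp (\<lambda>p q :: ('n, real) mpoly. p - q \<in> chosen_prime)"
  proof (rule transpI)
    fix p q r :: "('n, real) mpoly"
    assume "p - q \<in> chosen_prime" "q - r \<in> chosen_prime"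
    from chosen_add[OF this] show "p - r \<in> chosen_prime" by simp
  qed
qed

instantiation coord_ring :: (finite) idom
begin

lift_definition zero_coord_ring :: "'a coord_ring" is 0 .
lift_definition one_coord_ring :: "'a coord_ring" is 1 .
lift_definition plus_coord_ring :: "'a coord_ring \<Rightarrow> 'a coord_ring \<Rightarrow> 'a coord_ring" is "(+)"
proof -
  fix p p' q q' :: "('a, real) mpoly"
  assume "p - p' \<in> chosen_prime" "q - q' \<in> chosen_prime"
  from chosen_add[OF this] show "p + q - (p' + q') \<in> chosen_prime" by (simp add: algebra_simps)
qed
lift_definition uminus_coord_ring :: "'a coord_ring \<Rightarrow> 'a coord_ring" is uminus
proof -
  fix p p' :: "('a, real) mpoly"
  assume "p - p' \<in> chosen_prime"
  from chosen_neg[OF this] show "- p - - p' \<in> chosen_prime" by simp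
qed
lift_definition minus_coord_ring :: "'a coord_ring \<Rightarrow> 'a coord_ring \<Rightarrow> 'a coord_ring" is "(-)"
proof -
  fix p p' q q' :: "('a, real) mpoly"
  assume "p - p' \<in> chosen_prime" "q - q' \<in> chosen_prime"
  from chosen_diff[OF this] show "p - q - (p' - q') \<in> chosen_prime" by (simp add: algebra_simps)
qed
lift_definition times_coord_ring :: "'a coord_ring \<Rightarrow> 'a coord_ring \<Rightarrow> 'a coord_ring" is "(*)"
proof -
  fix p p' q q' :: "('a, real) mpoly"
  assume "p - p' \<in> chosen_prime" "q - q' \<in> chosen_prime"
  then have "p * (q - q') + q' * (p - p') \<in> chosen_prime" by (intro chosen_add chosen_scale)
  then show "p * q - p' * q' \<in> chosen_prime" by (simp add: algebra_simps)
qed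

instance
proof
  fix a b c :: "'a coord_ring"
  show "a + b + c = a + (b + c)" by transfer (simp add: chosen_0 add.assoc)
  show "a + b = b + a" by transfer (simp add: chosen_0 add.commute)
  show "0 + a = a" by transfer (simp add: chosen_0)
  show "- a + a = 0" by transfer (simp add: chosen_0)
  show "a - b = a + - b" by transfer (simp add: chosen_0)
  show "a * b * c = a * (b * c)" by transfer (simp add: chosen_0 mult.assoc)
  show "a * b = b * a" by transfer (simp add: chosen_0 mult.commute)
  show "1 * a = a" by transfer (simp add: chosen_0)
  show "(a + b) * c = a * c + b * c" by transfer (simp add: chosen_0 distrib_right)
  show "0 * a = 0" "a * 0 = 0" by (transfer, simp add: chosen_0)+
  show "a * (b + c) = a * b + a * c" by transfer (simp add: chosen_0 distrib_left)
  show "(0 :: 'a coord_ring) \<noteq> 1"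
  proof transfer
    show "0 - 1 \<notin> (chosen_prime :: ('a, real) mpoly set)"
      using chosen_neg[of "- 1"] one_notin_chosen by auto
  qed
  show "a \<noteq> 0 \<Longrightarrow> b \<noteq> 0 \<Longrightarrow> a * b \<noteq> 0"
  proof transfer
    fix a b :: "('a, real) mpoly"
    assume "a - 0 \<notin> chosen_prime" "b - 0 \<notin> chosen_prime"
    then show "a * b - 0 \<notin> chosen_prime" using chosen_prime_mult[of a b] by auto
  qed
qed

end

definition to_coord :: "('n :: finite, real) mpoly \<Rightarrow> 'n coord_ring" where
  "to_coord = abs_coord_ring"

lemma coeff_hom_to_coord: "coeff_hom to_coord"
  unfolding to_coord_def
  by standard (simp_all add: zero_coord_ring.abs_eq one_coord_ring.abs_eq
      plus_coord_ring.abs_eq times_coord_ring.abs_eq)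

lemma to_coord_eq_0_iff: "to_coord p = 0 \<longleftrightarrow> p \<in> chosen_prime"
  by (simp add: to_coord_def zero_coord_ring.abs_eq coord_ring.abs_eq_iff)

lemma to_coord_surj: "\<exists>p. to_coord p = a"
  by (rule coord_ring.abs_induct[of "\<lambda>a. \<exists>p. to_coord p = a"]) (auto simp: to_coord_def)

instance coord_ring :: (finite) formally_real_idom
proof
  fix n :: nat and f :: "nat \<Rightarrow> 'a coord_ring" and b :: "'a coord_ring"
  interpret coeff_hom "to_coord :: _ \<Rightarrow> 'a coord_ring" by (rule coeff_hom_to_coord)
  assume *: "(\<Sum>k<n. f k * f k) + b * b = 0"
  obtain g where g: "\<And>k. to_coord (g k) = f k" using to_coord_surj[of "f _"] by metis
  obtain c where c: "to_coord c = b" using to_coord_surj by metis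
  have "to_coord ((\<Sum>k<n. g k * g k) + c * c) = 0" using * by (simp add: hom_sum g c)
  then have "c \<in> chosen_prime"
    using chosen_prime_real[of "\<Sum>k<n. g k * g k" c] unfolding to_coord_eq_0_iff is_sos_iff_sum by blast
  then show "b = 0" using c to_coord_eq_0_iff by metis
qed

section \<open>The real Nullstellensatz\<close>

text \<open>
  A homomorphism on a polynomial ring is evaluation at the images of the variables.
\<close>

lemma hom_eq_eval_via:
  fixes \<psi> :: "('n :: finite, 'a :: comm_ring_1) mpoly \<Rightarrow> 'b :: comm_ring_1"
  assumes "coeff_hom \<psi>"
  shows "\<psi> p = eval_via (\<lambda>c. \<psi> (mp_const c)) (\<lambda>i. \<psi> (Poly_Mapping.single (Poly_Mapping.single i 1) 1)) p"
proof -
  interpret coeff_hom \<psi> by fact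
  let ?X = "\<lambda>i. Poly_Mapping.single (Poly_Mapping.single i 1) 1 :: ('n, 'a) mpoly"
  have pow: "?X i ^ k = Poly_Mapping.single (Poly_Mapping.single i k) 1" for i k
    by (induction k) (simp_all add: mult_single flip: single_add)
  have prod: "(\<Prod>i\<in>A. Poly_Mapping.single (e i) (1 :: 'a)) = Poly_Mapping.single (\<Sum>i\<in>A. e i) 1"
    if "finite A" for A :: "'n set" and e :: "'n \<Rightarrow> 'n \<Rightarrow>\<^sub>0 nat"
    using that by (induction A rule: finite_induct) (simp_all add: mult_single)
  have "(\<Sum>i\<in>UNIV. Poly_Mapping.single i (Poly_Mapping.lookup a i)) = a" for a :: "'n \<Rightarrow>\<^sub>0 nat"
    by (rule poly_mapping_eqI) (simp add: lookup_sum lookup_single when_def)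
  then have mono: "Poly_Mapping.single a c = mp_const c * (\<Prod>i\<in>UNIV. ?X i ^ Poly_Mapping.lookup a i)" for a c
    unfolding pow by (simp add: prod mp_const_def mult_single)
  have "\<psi> p = \<psi> (\<Sum>a\<in>Poly_Mapping.keys p. Poly_Mapping.single a (Poly_Mapping.lookup p a))"
    by (simp only: poly_mapping_sum_single[symmetric])
  also have "\<dots> = (\<Sum>a\<in>Poly_Mapping.keys p. \<psi> (Poly_Mapping.single a (Poly_Mapping.lookup p a)))"
    by (rule hom_sum)
  also have "\<dots> = eval_via (\<lambda>c. \<psi> (mp_const c)) (\<lambda>i. \<psi> (?X i)) p"
    unfolding eval_via_def by (intro sum.cong refl) (subst mono, simp add: hom_prod del: One_nat_def)
  finally show ?thesis .
qed

lemma coeff_hom_mp_const: "coeff_hom (mp_const :: 'a :: comm_ring_1 \<Rightarrow> ('n, 'a) mpoly)"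
  by standard (simp_all add: mp_const_def single_add mult_single)

lemma coeff_hom_comp: "coeff_hom f \<Longrightarrow> coeff_hom g \<Longrightarrow> coeff_hom (\<lambda>x. f (g x))"
  by (simp add: coeff_hom_def)

lemma coeff_hom_to_fract: "coeff_hom to_fract"
  by standard simp_all

text \<open>
  Otherwise there is an unsolvable system inside the chosen ideal. The classes of the variables are a
  zero of it in the real closure of the function field, and transfer makes it solvable.
\<close>

theorem unsolvable_imp_sos_certificate:
  fixes G :: "('n :: finite, real) mpoly set"
  assumes "finite G" "\<not> solvable G"
  obtains s where "is_sos s" "1 + s \<in> ideal.span G"
proof (rule ccontr)
  assume no: "\<not> thesis"
  have "1 + s \<notin> ideal.span G" if s: "is_sos s" for s using no \<open>\<And>s. is_sos s \<Longrightarrow> 1 + s \<in> ideal.span G \<Longrightarrow> thesis\<close> s by blast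
  then obtain J where J: "ideal.span G \<subseteq> J" "real_prime J"
    using real_prime_exists[OF ideal.subspace_span] by metis
  have "G \<subseteq> J" using J(1) ideal.span_superset by blast
  then obtain G' where G': "finite G'" "\<not> solvable G'" "G' \<subseteq> (chosen_prime :: ('n, real) mpoly set)"
    using chosen_prime_bad[OF assms J(2)] by blast
  define \<psi> :: "('n, real) mpoly \<Rightarrow> 'n coord_ring fract real_closure" where
    "\<psi> p = base_rc (to_fract (to_coord p))" for p
  have \<psi>: "coeff_hom \<psi>" unfolding \<psi>_def
    by (intro coeff_hom_comp[OF coeff_hom_base_rc] coeff_hom_comp[OF coeff_hom_to_fract] coeff_hom_to_coord)
  have \<iota>: "coeff_hom (\<lambda>c. \<psi> (mp_const c))" by (rule coeff_hom_comp[OF \<psi> coeff_hom_mp_const])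
  interpret base: coeff_hom "base_rc :: 'n coord_ring fract \<Rightarrow> _" by (rule coeff_hom_base_rc)
  have "\<psi> g = 0" if "g \<in> G'" for g
    using that G'(3) to_coord_eq_0_iff[of g] by (auto simp: \<psi>_def)
  then have "solvable G'"
    using solvable_transfer[OF \<iota> G'(1)] hom_eq_eval_via[OF \<psi>] by metis
  then show False using G'(2) by blast
qed

text \<open>
  Since \<open>1\<close> is its own power, the exponent in the definition of the real radical disappears.
\<close>

lemma one_in_real_radical_iff: "1 \<in> real_radical I \<longleftrightarrow> (\<exists>s. is_sos s \<and> 1 + s \<in> I)"
proof -
  have "is_sos s \<longleftrightarrow> (\<exists>b h. s = (\<Sum>i\<in>{1..b :: nat}. (h i)\<^sup>2))" for s :: "('a, real) mpoly"
  proof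
    assume "is_sos s"
    then obtain n f where "s = (\<Sum>k<n :: nat. f k * f k)" unfolding is_sos_iff_sum by blast
    then have "s = (\<Sum>i\<in>{1..n}. (f (i - 1))\<^sup>2)"
      by (simp add: sum.atLeast1_atMost_eq power2_eq_square)
    then show "\<exists>b h. s = (\<Sum>i\<in>{1..b :: nat}. (h i)\<^sup>2)" by (intro exI[of _ n] exI[of _ "\<lambda>i. f (i - 1)"])
  next
    assume "\<exists>b h. s = (\<Sum>i\<in>{1..b :: nat}. (h i)\<^sup>2)"
    then obtain b h where "s = (\<Sum>i\<in>{1..b :: nat}. (h i)\<^sup>2)" by blast
    then have "s = (\<Sum>k<b. h (Suc k) * h (Suc k))"
      by (simp add: sum.atLeast1_atMost_eq power2_eq_square)
    then show "is_sos s" unfolding is_sos_iff_sum by (intro exI[of _ b] exI[of _ "\<lambda>k. h (Suc k)"])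
  qed
  then show ?thesis unfolding real_radical_def by auto
qed

theorem solvable_iff_one_notin_real_radical:
  fixes G :: "('n :: finite, real) mpoly set"
  assumes "finite G"
  shows "solvable G \<longleftrightarrow> 1 \<notin> real_radical (ideal.span G)"
proof
  assume "solvable G"
  then obtain x where x: "\<And>g. g \<in> G \<Longrightarrow> mp_eval x g = 0" unfolding solvable_def by blast
  interpret coeff_hom "mp_eval x" by (rule coeff_hom_mp_eval)
  show "1 \<notin> real_radical (ideal.span G)"
    unfolding one_in_real_radical_iff
  proof clarify
    fix s assume s: "is_sos s" "1 + s \<in> ideal.span G"
    then have "1 + mp_eval x s = 0" using span_subset_vanishing[OF x s(2)] by simp
    then show False using mp_eval_sos_nonneg[OF s(1), of x] by simp
  qed
next
  assume "1 \<notin> real_radical (ideal.span G)"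
  then show "solvable G"
    using unsolvable_imp_sos_certificate[OF assms] unfolding one_in_real_radical_iff by blast
qed

section \<open>The complex Nullstellensatz\<close>

definition mp_var :: "'n \<Rightarrow> ('n, 'a :: comm_ring_1) mpoly" where
  "mp_var i = Poly_Mapping.single (Poly_Mapping.single i 1) 1"

lemma underdetermined_system:
  fixes v :: "'b \<Rightarrow> 'c \<Rightarrow> 'a :: field"
  assumes "finite K" "finite L" "card K < card L"
  shows "\<exists>\<alpha>. (\<exists>l\<in>L. \<alpha> l \<noteq> 0) \<and> (\<forall>k\<in>K. (\<Sum>l\<in>L. \<alpha> l * v l k) = 0)"
  using assms
proof (induction K arbitrary: L v rule: finite_induct)
  case empty
  then have "L \<noteq> {}" by auto
  then show ?case by (intro exI[of _ "\<lambda>_. 1"]) auto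
next
  case (insert a K)
  show ?case
  proof (cases "\<forall>l\<in>L. v l a = 0")
    case True
    obtain \<alpha> where "\<exists>l\<in>L. \<alpha> l \<noteq> 0" "\<forall>k\<in>K. (\<Sum>l\<in>L. \<alpha> l * v l k) = 0"
      using insert.IH[of L v] insert.prems insert.hyps by auto
    then show ?thesis using True by (intro exI[of _ \<alpha>]) auto
  next
    case False
    then obtain m where m: "m \<in> L" "v m a \<noteq> 0" by blast
    \<comment> \<open>Gaussian elimination with pivot \<open>v m a\<close>.\<close>
    define w where "w l k = v l k - v l a / v m a * v m k" for l k
    have "card K < card (L - {m})" using insert m by simp
    then obtain \<beta> where \<beta>: "\<exists>l\<in>L - {m}. \<beta> l \<noteq> 0" "\<forall>k\<in>K. (\<Sum>l\<in>L - {m}. \<beta> l * w l k) = 0"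
      using insert.IH[of "L - {m}" w] insert.prems by auto
    define \<alpha> where "\<alpha> = \<beta>(m := - (\<Sum>l\<in>L - {m}. \<beta> l * (v l a / v m a)))"
    have sum: "(\<Sum>l\<in>L. \<alpha> l * v l k) = (\<Sum>l\<in>L - {m}. \<beta> l * w l k)" for k
    proof -
      have "(\<Sum>l\<in>L. \<alpha> l * v l k) = \<alpha> m * v m k + (\<Sum>l\<in>L - {m}. \<beta> l * v l k)"
        using m insert.prems by (subst sum.remove[of L m]) (auto simp: \<alpha>_def intro!: sum.cong)
      also have "\<dots> = (\<Sum>l\<in>L - {m}. \<beta> l * v l k - \<beta> l * (v l a / v m a) * v m k)"
        by (simp add: \<alpha>_def sum_subtractf sum_distrib_right)
      also have "\<dots> = (\<Sum>l\<in>L - {m}. \<beta> l * w l k)"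
        by (intro sum.cong refl) (simp add: w_def right_diff_distrib mult.assoc)
      finally show ?thesis .
    qed
    have "w l a = 0" for l using m by (simp add: w_def)
    then have "(\<Sum>l\<in>L. \<alpha> l * v l k) = 0" if "k \<in> Set.insert a K" for k
      using that \<beta>(2) by (auto simp: sum)
    moreover have "\<exists>l\<in>L. \<alpha> l \<noteq> 0" using \<beta>(1) by (auto simp: \<alpha>_def)
    ultimately show ?thesis by blast
  qed
qed

lemma uncountable_fibre:
  assumes "uncountable (UNIV :: 'a set)" "countable (range f)"
  obtains y where "infinite {x :: 'a. f x = y}"
proof (rule ccontr)
  assume "\<not> thesis"
  then have "countable {x. f x = y}" for y using that by (auto intro: countable_finite)
  then have "countable (\<Union>y\<in>range f. {x. f x = y})" using assms(2) by blast
  moreover have "(\<Union>y\<in>range f. {x. f x = y}) = UNIV" by auto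
  ultimately show False using assms(1) by simp
qed

lemma countable_exponents: "countable (UNIV :: ('n :: finite \<Rightarrow>\<^sub>0 nat) set)"
proof -
  have "inj (Poly_Mapping.lookup :: ('n \<Rightarrow>\<^sub>0 nat) \<Rightarrow> 'n \<Rightarrow> nat)"
    by (rule injI) (rule poly_mapping_eqI, simp)
  then show ?thesis
    using countable_image_inj_on[of Poly_Mapping.lookup UNIV] countable_subset[OF subset_UNIV]
      countableI_type[where 'a = "'n \<Rightarrow> nat"] by metis
qed

lemma lookup_mp_const_mult: "Poly_Mapping.lookup (mp_const a * p) k = a * Poly_Mapping.lookup p k"
  unfolding mp_const_def mult_map_scale_conv_mult[symmetric]
  by (simp add: Poly_Mapping.map.rep_eq when_def)

text \<open>
  Polynomials have countably many possible supports, so infinitely many members of the family share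
  one support \<open>K\<close>, and any \<open>card K + 1\<close> of them are dependent.
\<close>

lemma uncountable_mpoly_dependent:
  fixes c :: "'a :: field \<Rightarrow> ('n :: finite, 'a) mpoly"
  assumes "uncountable (UNIV :: 'a set)"
  obtains L \<alpha> where "finite L" "\<exists>l\<in>L. \<alpha> l \<noteq> 0" "(\<Sum>l\<in>L. mp_const (\<alpha> l) * c l) = 0"
proof -
  have "countable {K :: ('n \<Rightarrow>\<^sub>0 nat) set. finite K \<and> K \<subseteq> UNIV}"
    by (rule countable_Collect_finite_subset[OF countable_exponents])
  then have "countable (range (\<lambda>l. Poly_Mapping.keys (c l)))"
    by (rule countable_subset[rotated]) auto
  then obtain K where K: "infinite {l. Poly_Mapping.keys (c l) = K}"
    using uncountable_fibre[OF assms, of "\<lambda>l. Poly_Mapping.keys (c l)"] by blast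
  obtain L where L: "L \<subseteq> {l. Poly_Mapping.keys (c l) = K}" "finite L" "card L = Suc (card K)"
    using infinite_arbitrarily_large[OF K] by blast
  then obtain l where "l \<in> L" by fastforce
  then have "finite K" using L(1) by auto
  then obtain \<alpha> where \<alpha>: "\<exists>l\<in>L. \<alpha> l \<noteq> 0" "\<forall>k\<in>K. (\<Sum>l\<in>L. \<alpha> l * Poly_Mapping.lookup (c l) k) = 0"
    using underdetermined_system[of K L "\<lambda>l. Poly_Mapping.lookup (c l)"] L by auto
  have "(\<Sum>l\<in>L. \<alpha> l * Poly_Mapping.lookup (c l) k) = 0" for k
  proof (cases "k \<in> K")
    case False
    then have "Poly_Mapping.lookup (c l) k = 0" if "l \<in> L" for l using L(1) that by (auto simp: in_keys_iff)
    then show ?thesis by simp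
  qed (use \<alpha> in blast)
  then have "(\<Sum>l\<in>L. mp_const (\<alpha> l) * c l) = 0"
    by (intro poly_mapping_eqI)
      (simp add: lookup_sum lookup_mp_const_mult)
  then show ?thesis using that L(2) \<alpha>(1) by blast
qed

lemma prime_contains_linear_factor:
  fixes q :: "'a :: alg_closed_field poly" and x :: "('n, 'a) mpoly"
  assumes M: "ideal.subspace M" "1 \<notin> M" "\<And>a b. a * b \<in> M \<Longrightarrow> a \<in> M \<or> b \<in> M"
  shows "q \<noteq> 0 \<Longrightarrow> poly (map_poly mp_const q) x \<in> M \<Longrightarrow> \<exists>l. x - mp_const l \<in> M"
proof (induction "degree q" arbitrary: q rule: less_induct)
  case less
  interpret coeff_hom "mp_const :: 'a \<Rightarrow> ('n, 'a) mpoly" by (rule coeff_hom_mp_const)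
  show ?case
  proof (cases "degree q = 0")
    case True
    then obtain c where c: "q = [:c:]" using degree_eq_zeroE by blast
    then have "mp_const c \<in> M" "c \<noteq> 0" using less.prems by (auto simp: map_poly_pCons)
    from ideal.subspace_scale[OF M(1) this(1), of "mp_const (inverse c)"] this(2)
    have "1 \<in> M" by (simp flip: hom_mult)
    then show ?thesis using M(2) by blast
  next
    case False
    then obtain l where "poly q l = 0" using alg_closed_imp_poly_has_root[of q] by auto
    then obtain r where r: "q = [:- l, 1:] * r" by (metis poly_eq_0_iff_dvd dvdE)
    then have "r \<noteq> 0" using less.prems by auto
    then have "degree r < degree q" unfolding r by (subst degree_mult_eq) auto
    have "poly (map_poly mp_const q) x = (x - mp_const l) * poly (map_poly mp_const r) x"
      unfolding r map_poly_hom_mult by (simp add: map_poly_pCons algebra_simps)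
    then consider "x - mp_const l \<in> M" | "poly (map_poly mp_const r) x \<in> M"
      using M(3) less.prems(2) by metis
    then show ?thesis using less.hyps[OF \<open>degree r < degree q\<close> \<open>r \<noteq> 0\<close>] by cases blast+
  qed
qed

text \<open>
  With \<open>c \<lambda>\<close> an inverse of \<open>x - \<lambda>\<close> modulo \<open>M\<close>, a dependency \<open>\<Sum>\<alpha> \<lambda> * c \<lambda> = 0\<close> is multiplied by
  \<open>P = \<Prod>(x - \<lambda>)\<close>. Modulo \<open>M\<close> this gives \<open>\<Sum>\<alpha> \<lambda> * P / (x - \<lambda>)\<close>, the value at \<open>x\<close> of a univariate
  polynomial \<open>q\<close> that does not vanish at any \<open>\<lambda>\<close> with \<open>\<alpha> \<lambda> \<noteq> 0\<close>.
\<close>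

lemma maximal_contains_linear:
  fixes x :: "('n :: finite, 'a :: alg_closed_field) mpoly"
  assumes M: "ideal.subspace M" "1 \<notin> M" "\<And>a. a \<notin> M \<Longrightarrow> \<exists>c. c * a - 1 \<in> M"
    and unc: "uncountable (UNIV :: 'a set)"
  obtains l where "x - mp_const l \<in> M"
proof (rule ccontr)
  assume "\<not> thesis"
  then have out: "x - mp_const l \<notin> M" for l using that by blast
  note scale = ideal.subspace_scale[OF M(1)] and diff = ideal.subspace_diff[OF M(1)]
  interpret coeff_hom "mp_const :: 'a \<Rightarrow> ('n, 'a) mpoly" by (rule coeff_hom_mp_const)
  obtain c where c: "\<And>l. c l * (x - mp_const l) - 1 \<in> M" using M(3)[OF out] by metis
  obtain L \<alpha> where L: "finite L" "\<exists>l\<in>L. \<alpha> l \<noteq> 0" "(\<Sum>l\<in>L. mp_const (\<alpha> l) * c l) = 0"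
    using uncountable_mpoly_dependent[OF unc] by metis
  define q where "q = (\<Sum>l\<in>L. smult (\<alpha> l) (\<Prod>m\<in>L - {l}. [:- m, 1:]))"
  obtain l0 where l0: "l0 \<in> L" "\<alpha> l0 \<noteq> 0" using L(2) by blast
  have "poly q l0 = (\<Sum>l\<in>L. if l = l0 then \<alpha> l0 * (\<Prod>m\<in>L - {l0}. l0 - m) else 0)"
    unfolding q_def poly_sum using L(1) l0(1) by (intro sum.cong) (auto simp: poly_prod)
  also have "\<dots> = \<alpha> l0 * (\<Prod>m\<in>L - {l0}. l0 - m)" using L(1) l0(1) by simp
  finally have "poly q l0 \<noteq> 0" using l0 L(1) by (simp add: prod_zero_iff)
  then have "q \<noteq> 0" by auto
  have map_sum: "(map_poly mp_const (sum f A) :: ('n, 'a) mpoly poly) = (\<Sum>a\<in>A. map_poly mp_const (f a))"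
    for f :: "'a \<Rightarrow> 'a poly" and A
    by (induction A rule: infinite_finite_induct) (auto simp: map_poly_hom_add)
  have map_prod: "(map_poly mp_const (prod f A) :: ('n, 'a) mpoly poly) = (\<Prod>a\<in>A. map_poly mp_const (f a))"
    for f :: "'a \<Rightarrow> 'a poly" and A
    by (induction A rule: infinite_finite_induct) (auto simp: map_poly_hom_mult)
  define P where "P = (\<Prod>m\<in>L. x - mp_const m)"
  define R where "R l = (\<Prod>m\<in>L - {l}. x - mp_const m)" for l
  have eval_q: "poly (map_poly mp_const q) x = (\<Sum>l\<in>L. mp_const (\<alpha> l) * R l)"
    unfolding q_def R_def map_sum map_poly_hom_smult map_prod
    by (simp add: poly_sum poly_prod map_poly_pCons)
  have "mp_const (\<alpha> l) * R l * (c l * (x - mp_const l) - 1) = mp_const (\<alpha> l) * c l * P - mp_const (\<alpha> l) * R l"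
    if "l \<in> L" for l
  proof -
    have P: "P = (x - mp_const l) * R l"
      unfolding P_def R_def using L(1) that by (rule prod.remove)
    show ?thesis unfolding P by (simp add: algebra_simps)
  qed
  then have "(\<Sum>l\<in>L. mp_const (\<alpha> l) * R l * (c l * (x - mp_const l) - 1)) =
      (\<Sum>l\<in>L. mp_const (\<alpha> l) * c l) * P - poly (map_poly mp_const q) x"
    by (simp add: eval_q sum_subtractf sum_distrib_right)
  moreover have "(\<Sum>l\<in>L. mp_const (\<alpha> l) * R l * (c l * (x - mp_const l) - 1)) \<in> M"
    by (intro ideal.subspace_sum[OF M(1)] scale c)
  ultimately have "- poly (map_poly mp_const q) x \<in> M" using L(3) by simp
  from ideal.subspace_neg[OF M(1) this] have "poly (map_poly mp_const q) x \<in> M" by simp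
  moreover have "a \<in> M \<or> b \<in> M" if "a * b \<in> M" for a b
  proof (rule disjCI)
    assume "b \<notin> M"
    then obtain d where "d * b - 1 \<in> M" using M(3) by blast
    from diff[OF scale[OF that, of d] scale[OF this, of a]] show "a \<in> M" by (simp add: algebra_simps)
  qed
  ultimately show False
    using prime_contains_linear_factor[OF M(1,2) _ \<open>q \<noteq> 0\<close>] out by blast
qed

lemma eval_via_cong_ideal:
  fixes u v :: "'n :: finite \<Rightarrow> 'b :: comm_ring_1"
  assumes M: "ideal.subspace M" and uv: "\<And>i. u i - v i \<in> M"
  shows "eval_via \<iota> u p - eval_via \<iota> v p \<in> M"
proof -
  have mult: "a * b - a' * b' \<in> M" if "a - a' \<in> M" "b - b' \<in> M" for a a' b b'
  proof -
    have "b * (a - a') + a' * (b - b') \<in> M"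
      using that by (intro ideal.subspace_add[OF M] ideal.subspace_scale[OF M])
    then show ?thesis by (simp add: algebra_simps)
  qed
  have zero: "a - a \<in> M" for a using ideal.subspace_0[OF M] by simp
  have pow: "u i ^ k - v i ^ k \<in> M" for i k
    by (induction k) (auto intro: mult zero[of 1, simplified] uv ideal.subspace_0[OF M])
  have prod: "(\<Prod>i\<in>A. u i ^ e i) - (\<Prod>i\<in>A. v i ^ e i) \<in> M" if "finite A" for A and e :: "'n \<Rightarrow> nat"
    using that by (induction A rule: finite_induct) (auto intro: mult pow ideal.subspace_0[OF M])
  show ?thesis unfolding eval_via_def sum_subtractf[symmetric]
    by (intro ideal.subspace_sum[OF M] mult zero prod) simp
qed

text \<open>
  A maximal ideal contains \<open>x\<^sub>i - \<lambda>\<^sub>i\<close> for suitable \<open>\<lambda>\<^sub>i\<close>, so each polynomial is congruent to its value at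
  \<open>\<lambda>\<close>; for a member of the ideal this value is a constant in the ideal, hence zero.
\<close>

theorem solvable_iff_one_notin_ideal:
  fixes G :: "('n :: finite, 'a :: alg_closed_field) mpoly set"
  assumes unc: "uncountable (UNIV :: 'a set)"
  shows "solvable G \<longleftrightarrow> 1 \<notin> ideal.span G"
proof
  assume "solvable G"
  then obtain x where x: "\<And>g. g \<in> G \<Longrightarrow> mp_eval x g = 0" unfolding solvable_def by blast
  interpret coeff_hom "mp_eval x" by (rule coeff_hom_mp_eval)
  show "1 \<notin> ideal.span G"
  proof
    assume "1 \<in> ideal.span G"
    from span_subset_vanishing[OF x this] show False by simp
  qed
next
  assume "1 \<notin> ideal.span G"
  moreover define S where "S = {1 :: ('n, 'a) mpoly}"
  ultimately have "ideal.span G \<inter> S = {}" by simp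
  then obtain M where M0: "ideal.subspace M" "ideal.span G \<subseteq> M" "M \<inter> S = {}"
    and max: "\<And>a. a \<notin> M \<Longrightarrow> \<exists>j\<in>M. \<exists>c. j + c * a \<in> S"
    using maximal_disjoint_ideal[OF ideal.subspace_span] by metis
  then have M: "ideal.span G \<subseteq> M" "ideal.subspace M" "1 \<notin> M" by (auto simp: S_def)
  have inv: "\<exists>c. c * a - 1 \<in> M" if a: "a \<notin> M" for a
  proof -
    obtain j c where j: "j \<in> M" "j + c * a = 1" using max[OF a] unfolding S_def by blast
    have "c * a - 1 = - j" unfolding j(2)[symmetric] by simp
    then show ?thesis using ideal.subspace_neg[OF M(2) j(1)] by metis
  qed
  interpret C: coeff_hom "mp_const :: 'a \<Rightarrow> ('n, 'a) mpoly" by (rule coeff_hom_mp_const)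
  have "\<exists>l. mp_var i - mp_const l \<in> M" for i
    using maximal_contains_linear[OF M(2,3) inv unc] by metis
  then obtain l where l: "\<And>i. mp_var i - mp_const (l i) \<in> M" by metis
  have "mp_eval (\<chi> i. l i) g = 0" if g: "g \<in> G" for g
  proof (rule ccontr)
    let ?e = "mp_eval (\<chi> i. l i) g"
    assume e: "?e \<noteq> 0"
    have "g = eval_via mp_const mp_var g"
      using hom_eq_eval_via[OF coeff_hom_id, of g] by (simp add: mp_var_def[abs_def])
    moreover have "(mp_const ?e :: ('n, 'a) mpoly) = eval_via mp_const (\<lambda>i. mp_const (l i)) g"
      by (simp add: mp_eval_def eval_via_def C.hom_sum C.hom_prod)
    ultimately have "g - mp_const ?e \<in> M"
      using eval_via_cong_ideal[OF M(2), of mp_var "\<lambda>i. mp_const (l i)" mp_const g] l by simp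
    moreover have "g \<in> M" using M(1) g ideal.span_superset by blast
    ultimately have "mp_const ?e \<in> M" using ideal.subspace_diff[OF M(2), of g "g - mp_const ?e"] by simp
    from ideal.subspace_scale[OF M(2) this, of "mp_const (inverse ?e)"] e
    have "1 \<in> M" by (simp flip: C.hom_mult)
    then show False using M(3) by blast
  qed
  then show "solvable G" unfolding solvable_def by blast
qed

lemma uncountable_complex: "uncountable (UNIV :: complex set)"
proof
  assume "countable (UNIV :: complex set)"
  then have "countable (range complex_of_real)" by (rule countable_subset[OF subset_UNIV])
  then show False
    using uncountable_UNIV_real countable_image_inj_on[of complex_of_real UNIV]
    by (simp add: inj_of_real)
qed

section \<open>Implicit and parametric systems\<close>

lemma mp_eval_const [simp]: "mp_eval x (mp_const c) = c"
  unfolding mp_eval_eq_eval_via mp_const_def by (simp add: eval_via_single[OF coeff_hom_id])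

lemma mp_eval_diff: "mp_eval x (p - q) = mp_eval x p - mp_eval x q"
proof -
  interpret coeff_hom "mp_eval x" by (rule coeff_hom_mp_eval)
  show ?thesis by simp
qed

lemma poly_map_nth: "poly_map q x $ j = mp_eval x (q j)"
  by (simp add: poly_map_def)

lemma mp_eval_subst: "mp_eval t (mp_subst q p) = mp_eval (poly_map q t) p"
proof -
  interpret coeff_hom "mp_eval t" by (rule coeff_hom_mp_eval)
  have "mp_eval t (mp_subst q p) = (\<Sum>a\<in>Poly_Mapping.keys p. Poly_Mapping.lookup p a *
      (\<Prod>i\<in>UNIV. mp_eval t (q i) ^ Poly_Mapping.lookup a i))"
    unfolding mp_subst_def by (simp add: hom_sum hom_prod)
  then show ?thesis by (simp add: mp_eval_def[of "poly_map q t"] poly_map_nth)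
qed

lemma implicit_system_iff:
  assumes "\<forall>x\<in>X. \<mu> x = poly_map m x" "X = {x. \<forall>i\<in>{1..k}. mp_eval x (f i) = 0}"
  shows "(\<exists>x\<in>X. y = \<mu> x) \<longleftrightarrow> solvable (implicit_system k f m y)"
proof -
  have "(\<forall>g\<in>implicit_system k f m y. mp_eval x g = 0) \<longleftrightarrow> x \<in> X \<and> y = poly_map m x" for x
    unfolding implicit_system_def assms(2)
    by (auto simp: ball_Un vec_eq_iff poly_map_nth mp_eval_diff)
  then show ?thesis using assms(1) unfolding solvable_def by auto
qed

lemma parametric_system_iff:
  assumes "\<forall>x\<in>X. \<mu> x = poly_map m x" "X = range (poly_map \<phi>)"
  shows "(\<exists>x\<in>X. y = \<mu> x) \<longleftrightarrow> solvable (parametric_system \<phi> m y)"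
proof -
  have "(\<forall>g\<in>parametric_system \<phi> m y. mp_eval t g = 0) \<longleftrightarrow> y = poly_map m (poly_map \<phi> t)" for t
    unfolding parametric_system_def
    by (simp add: vec_eq_iff poly_map_nth[of m] mp_eval_diff mp_eval_subst)
  moreover have "(\<exists>x\<in>X. y = \<mu> x) \<longleftrightarrow> (\<exists>t. y = poly_map m (poly_map \<phi> t))"
    using assms by auto
  ultimately show ?thesis unfolding solvable_def by simp
qed

lemma finite_implicit_system: "finite (implicit_system k f (m :: _ :: finite \<Rightarrow> _) y)"
  by (simp add: implicit_system_def)

lemma finite_parametric_system: "finite (parametric_system \<phi> (m :: _ :: finite \<Rightarrow> _) y)"
  by (simp add: parametric_system_def)

theorem mainTheorem2:
  shows
    "(\<forall>(X :: (real ^ 'n::finite) set) (\<mu> :: real ^ 'n \<Rightarrow> real ^ 's::finite)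
        (m :: 's \<Rightarrow> ('n, real) mpoly) (y :: real ^ 's).
        (\<forall>x\<in>X. \<mu> x = poly_map m x) \<longrightarrow>
        (\<forall>(k :: nat) (f :: nat \<Rightarrow> ('n, real) mpoly).
           X = {x. \<forall>i\<in>{1..k}. mp_eval x (f i) = 0} \<longrightarrow>
             ((\<exists>x\<in>X. y = \<mu> x) \<longleftrightarrow> solvable (implicit_system k f m y)) \<and>
             (solvable (implicit_system k f m y) \<longleftrightarrow>
                1 \<notin> real_radical (ideal.span (implicit_system k f m y)))) \<and>
        (\<forall>\<phi> :: 'n \<Rightarrow> ('l::finite, real) mpoly.
           X = range (poly_map \<phi>) \<longrightarrow>
             ((\<exists>x\<in>X. y = \<mu> x) \<longleftrightarrow> solvable (parametric_system \<phi> m y)) \<and>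
             (solvable (parametric_system \<phi> m y) \<longleftrightarrow>
                1 \<notin> real_radical (ideal.span (parametric_system \<phi> m y))))) \<and>
     (\<forall>(X :: (complex ^ 'n) set) (\<mu> :: complex ^ 'n \<Rightarrow> complex ^ 's)
        (m :: 's \<Rightarrow> ('n, complex) mpoly) (y :: complex ^ 's).
        (\<forall>x\<in>X. \<mu> x = poly_map m x) \<longrightarrow>
        (\<forall>(k :: nat) (f :: nat \<Rightarrow> ('n, complex) mpoly).
           X = {x. \<forall>i\<in>{1..k}. mp_eval x (f i) = 0} \<longrightarrow>
             ((\<exists>x\<in>X. y = \<mu> x) \<longleftrightarrow> solvable (implicit_system k f m y)) \<and>
             (solvable (implicit_system k f m y) \<longleftrightarrow>
                1 \<notin> ideal.span (implicit_system k f m y))) \<and>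
        (\<forall>\<phi> :: 'n \<Rightarrow> ('l, complex) mpoly.
           X = range (poly_map \<phi>) \<longrightarrow>
             ((\<exists>x\<in>X. y = \<mu> x) \<longleftrightarrow> solvable (parametric_system \<phi> m y)) \<and>
             (solvable (parametric_system \<phi> m y) \<longleftrightarrow>
                1 \<notin> ideal.span (parametric_system \<phi> m y))))"

  by (intro conjI allI impI;
      (erule (1) implicit_system_iff | erule (1) parametric_system_iff |
       rule solvable_iff_one_notin_real_radical[OF finite_implicit_system]
         solvable_iff_one_notin_real_radical[OF finite_parametric_system]
         solvable_iff_one_notin_ideal[OF uncountable_complex]))

end
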